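(* Every element $x\in\mathfrak{F}_{2\mathbb{R}}$ of a given rank is related, by an element of the automorphism group $\mathrm{Aut}(\mathfrak{F}_{2\mathbb{R}})$ (identified with $\mathrm{SL}(2,\mathbb{R})\times\mathrm{SO}(2,1)$), to one of the following canonical forms: 1. Rank 1: (a) $x_1=\begin{pmatrix}1&0\\0&0\end{pmatrix}$. 2. Rank 2: (a) $x_{2a}=\begin{pmatrix}1&(1;0)\\0&0\end{pmatrix}$; (b) $x_{2b}=\begin{pmatrix}1&(-1;0)\\0&0\end{pmatrix}$. 3. Rank 3: (a) $x_{3a}=\begin{pmatrix}1&(0;1)\\0&0\end{pmatrix}$. 4. Rank 4: (a) $x_{4a}=k\begin{pmatrix}1&(-1;1)\\0&0\end{pmatrix}$; (b) $x_{4b}=k\begin{pmatrix}1&(1;1)\\0&0\end{pmatrix}$, where $k>0$.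
   Context: Jordan algebra. $\mathfrak{J}_{2\mathbb{R}}=\mathbb{R}\oplus\mathbb{R}$ with elements $A=(a;a_0)$, cubic norm $N(A)=a\,a_0^2$, base point $(1;1)$, trace bilinear form $\mathrm{Tr}(A,B)=ab+2a_0b_0$ and quadratic adjoint $A^\sharp=(a_0^2;\,a\,a_0)$. Freudenthal triple system. $\mathfrak{F}_{2\mathbb{R}}=\mathfrak{F}(\mathfrak{J}_{2\mathbb{R}})=\mathbb{R}\oplus\mathbb{R}\oplus\mathfrak{J}_{2\mathbb{R}}\oplus\mathfrak{J}_{2\mathbb{R}}$, with elements written $x=\begin{pmatrix}\alpha & A \\ B & \beta\end{pmatrix}$, $\alpha,\beta\in\mathbb{R}$, $A,B\in\mathfrak{J}_{2\mathbb{R}}$. For $y=\begin{pmatrix}\gamma & C \\ D & \delta\end{pmatrix}$, the antisymmetric bilinear form is $$\{x,y\}=\alpha\delta-\beta\gamma+\mathrm{Tr}(A,D)-\mathrm{Tr}(B,C),$$ and the quartic form is $$\Delta(x)=-(\alpha\beta-\mathrm{Tr}(A,B))^2-4[\alpha N(A)+\beta N(B)-\mathrm{Tr}(A^\sharp,B^\sharp)].$$ Let $\Delta(x,y,w,z)$ be its full symmetric linearization, normalized by $\Delta(x,x,x,x)=\Delta(x)$. The triple product $T$ is defined by $\{T(x,y,w),z\}=2\Delta(x,y,w,z)$ for all $z$, and $T(x):=T(x,x,x)$. Put $\Upsilon(x,x,y)=3T(x,x,y)+\{x,y\}x$. Rank. A non-zero $x$ has rank 1 iff $\Upsilon(x,x,y)=0$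 for all $y$; rank 2 iff $T(x)=0$ and $\Upsilon(x,x,y)\neq0$ for some $y$; rank 3 iff $\Delta(x)=0$ and $T(x)\neq0$; rank 4 iff $\Delta(x)\ne0$. Group. $\mathrm{Aut}(\mathfrak{F})$ is the group of invertible $\mathbb{R}$-linear maps $\sigma:\mathfrak{F}\to\mathfrak{F}$ with $\{\sigma x,\sigma y\}=\{x,y\}$ and $\Delta(\sigma x)=\Delta(x)$ for all $x,y$. Elements $x,x'$ are related if $x'=\sigma x$ for some $\sigma\in\mathrm{Aut}(\mathfrak{F})$. The real number $k>0$ depends on $x$. *)

theory Defs
  imports "HOL-Analysis.Analysis" "HOL-Algebra.Group"
begin

section \<open>The Jordan algebra\<close>

type_synonym jordan = "real \<times> real"

fun cubic_norm :: "jordan \<Rightarrow> real" where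
  "cubic_norm (a, a0) = a * a0\<^sup>2"

fun tr :: "jordan \<Rightarrow> jordan \<Rightarrow> real" where
  "tr (a, a0) (b, b0) = a * b + 2 * a0 * b0"

fun sharp :: "jordan \<Rightarrow> jordan" where
  "sharp (a, a0) = (a0\<^sup>2, a * a0)"

section \<open>The Freudenthal triple system\<close>

text \<open>The quadruple \<open>(\<alpha>, A, B, \<beta>)\<close> is the matrix with first row \<open>\<alpha>, A\<close> and second row
  \<open>B, \<beta>\<close>; the vector space structure is the one of the product type.\<close>

type_synonym fts = "real \<times> jordan \<times> jordan \<times> real"

fun sform :: "fts \<Rightarrow> fts \<Rightarrow> real" where
  "sform (\<alpha>, A, B, \<beta>) (\<gamma>, C, D, \<delta>) = \<alpha> * \<delta> - \<beta> * \<gamma> + tr A D - tr B C"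

fun quartic :: "fts \<Rightarrow> real" where
  "quartic (\<alpha>, A, B, \<beta>) =
     - (\<alpha> * \<beta> - tr A B)\<^sup>2
     - 4 * (\<alpha> * cubic_norm A + \<beta> * cubic_norm B - tr (sharp A) (sharp B))"

text \<open>The full linearization is given by the polarization formula; the lemmas below show that
  it is the symmetric 4-linear form with diagonal \<^const>\<open>quartic\<close>.\<close>

definition polar4 :: "(fts \<Rightarrow> real) \<Rightarrow> fts \<Rightarrow> fts \<Rightarrow> fts \<Rightarrow> fts \<Rightarrow> real" where
  "polar4 f x y w z =
    (f (x + y + w + z)
     - f (x + y + w) - f (x + y + z) - f (x + w + z) - f (y + w + z)
     + f (x + y) + f (x + w) + f (x + z) + f (y + w) + f (y + z) + f (w + z)
     - f x - f y - f w - f z) / 24"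

definition quartic4 :: "fts \<Rightarrow> fts \<Rightarrow> fts \<Rightarrow> fts \<Rightarrow> real" where
  "quartic4 = polar4 quartic"

lemma quartic4_diag: "quartic4 x x x x = quartic x"
proof -
  have scale: "quartic (c *\<^sub>R x) = c ^ 4 * quartic x" for c
  proof -
    obtain a1 a2 a3 a4 a5 a6 where x: "x = (a1, (a2, a3), (a4, a5), a6)" by (metis surj_pair)
    show ?thesis by (simp add: x power2_eq_square power4_eq_xxxx algebra_simps)
  qed
  have "x + x = 2 *\<^sub>R x" "2 *\<^sub>R x + x = 3 *\<^sub>R x" "3 *\<^sub>R x + x = 4 *\<^sub>R x"
    using scaleR_add_left[of 1 1 x] scaleR_add_left[of 2 1 x] scaleR_add_left[of 3 1 x]
    by simp_all
  then show ?thesis by (simp add: quartic4_def polar4_def scale)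
qed

lemma quartic4_commute:
  "quartic4 y x w z = quartic4 x y w z"
  "quartic4 x w y z = quartic4 x y w z"
  "quartic4 x y z w = quartic4 x y w z"
  by (simp_all add: quartic4_def polar4_def ac_simps)

definition quadratic_with :: "(fts \<Rightarrow> real) \<Rightarrow> (fts \<Rightarrow> fts \<Rightarrow> real) \<Rightarrow> bool" where
  "quadratic_with p b \<longleftrightarrow> bilinear b \<and> (\<forall>u v. p (u + v) = p u + p v + b u v)"

lemma quadratic_with_mult:
  assumes "linear f" "linear g"
  shows "quadratic_with (\<lambda>x. f x * g x) (\<lambda>u v. f u * g v + f v * g u)"
  unfolding quadratic_with_def bilinear_def
  by (intro conjI allI linearI)
    (simp_all add: linear_add[OF assms(1)] linear_add[OF assms(2)]
      linear_scale[OF assms(1)] linear_scale[OF assms(2)] algebra_simps)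

lemma quadratic_with_add:
  assumes "quadratic_with p b" "quadratic_with q c"
  shows "quadratic_with (\<lambda>x. p x + q x) (\<lambda>u v. b u v + c u v)"
  using assms unfolding quadratic_with_def bilinear_def
  by (auto intro: linear_compose_add)

lemma quadratic_polarization:
  fixes p1 :: real
  shows "(p1+p2+p3+p4+p12+p13+p14+p23+p24+p34) * (q1+q2+q3+q4+q12+q13+q14+q23+q24+q34)
  - (p1+p2+p3+p12+p13+p23) * (q1+q2+q3+q12+q13+q23)
  - (p1+p2+p4+p12+p14+p24) * (q1+q2+q4+q12+q14+q24)
  - (p1+p3+p4+p13+p14+p34) * (q1+q3+q4+q13+q14+q34)
  - (p2+p3+p4+p23+p24+p34) * (q2+q3+q4+q23+q24+q34)
  + (p1+p2+p12) * (q1+q2+q12) + (p1+p3+p13) * (q1+q3+q13) + (p1+p4+p14) * (q1+q4+q14)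
  + (p2+p3+p23) * (q2+q3+q23) + (p2+p4+p24) * (q2+q4+q24) + (p3+p4+p34) * (q3+q4+q34)
  - p1*q1 - p2*q2 - p3*q3 - p4*q4
  = p12*q34 + p13*q24 + p14*q23 + p23*q14 + p24*q13 + p34*q12"
  by (simp add: distrib_left distrib_right)

lemma linear_polar4_mult:
  assumes "quadratic_with p b" "quadratic_with q c"
  shows "linear (polar4 (\<lambda>x. p x * q x) x y w)"
proof -
  have b: "bilinear b" and c: "bilinear c"
    and p: "p (u + v) = p u + p v + b u v" and q: "q (u + v) = q u + q v + c u v" for u v
    using assms unfolding quadratic_with_def by blast+
  have p3: "p (u + v + s) = p u + p v + p s + b u v + b u s + b v s"
    and q3: "q (u + v + s) = q u + q v + q s + c u v + c u s + c v s" for u v s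
    by (simp_all add: p q bilinear_ladd[OF b] bilinear_ladd[OF c])
  have p4: "p (u + v + s + t) =
      p u + p v + p s + p t + b u v + b u s + b u t + b v s + b v t + b s t"
    and q4: "q (u + v + s + t) =
      q u + q v + q s + q t + c u v + c u s + c u t + c v s + c v t + c s t" for u v s t
    by (simp_all add: p q bilinear_ladd[OF b] bilinear_ladd[OF c])
  have "polar4 (\<lambda>x. p x * q x) x y w z =
    (b x y * c w z + b x w * c y z + b x z * c y w + b y w * c x z + b y z * c x w + b w z * c x y)
      / 24" for z
    unfolding polar4_def p4 q4
    unfolding p3 q3
    unfolding p q by (simp only: quadratic_polarization)
  then have eq: "polar4 (\<lambda>x. p x * q x) x y w = (\<lambda>z.
    (b x y * c w z + b x w * c y z + b x z * c y w + b y w * c x z + b y z * c x w + b w z * c x y)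
      / 24)"
    by blast
  show ?thesis unfolding eq
    by (rule linearI)
      (simp_all add: bilinear_radd[OF b] bilinear_radd[OF c] bilinear_rmul[OF b]
        bilinear_rmul[OF c] algebra_simps add_divide_distrib)
qed

lemma linear_quartic4: "linear (quartic4 x y w)"
proof -
  define \<alpha> :: "fts \<Rightarrow> real" where "\<alpha> = (\<lambda>x. fst x)"
  define a :: "fts \<Rightarrow> real" where "a = (\<lambda>x. fst (fst (snd x)))"
  define a0 :: "fts \<Rightarrow> real" where "a0 = (\<lambda>x. snd (fst (snd x)))"
  define b :: "fts \<Rightarrow> real" where "b = (\<lambda>x. fst (fst (snd (snd x))))"
  define b0 :: "fts \<Rightarrow> real" where "b0 = (\<lambda>x. snd (fst (snd (snd x))))"
  define \<beta> :: "fts \<Rightarrow> real" where "\<beta> = (\<lambda>x. snd (snd (snd x)))"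
  note defs = \<alpha>_def a_def a0_def b_def b0_def \<beta>_def
  have lin: "linear \<alpha>" "linear a" "linear a0" "linear b" "linear b0" "linear \<beta>"
    "linear (\<lambda>x. - a x)" "linear (\<lambda>x. - 2 * a0 x)"
    unfolding defs by (auto intro!: linearI)
  note quad = quadratic_with_mult[OF lin(1) lin(6)] quadratic_with_mult[OF lin(7) lin(4)]
    quadratic_with_mult[OF lin(8) lin(5)]
  define P where "P = (\<lambda>x. \<alpha> x * \<beta> x + - a x * b x + - 2 * a0 x * b0 x)"
  have P: "\<exists>c. quadratic_with P c"
    unfolding P_def using quadratic_with_add[OF quadratic_with_add[OF quad(1,2)] quad(3)] by blast
  let ?f1 = "\<lambda>x. P x * P x"
  let ?f2 = "\<lambda>x. (\<alpha> x * a x) * (a0 x * a0 x)"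
  let ?f3 = "\<lambda>x. (\<beta> x * b x) * (b0 x * b0 x)"
  let ?f4 = "\<lambda>x. (a0 x * a0 x) * (b0 x * b0 x)"
  let ?f5 = "\<lambda>x. (a x * a0 x) * (b x * b0 x)"
  have l: "linear (polar4 ?f1 x y w)" "linear (polar4 ?f2 x y w)" "linear (polar4 ?f3 x y w)"
    "linear (polar4 ?f4 x y w)" "linear (polar4 ?f5 x y w)"
    using P by (auto intro!: linear_polar4_mult quadratic_with_mult lin)
  have q: "quartic = (\<lambda>x. - 1 * ?f1 x + - 4 * ?f2 x + - 4 * ?f3 x + 4 * ?f4 x + 8 * ?f5 x)"
  proof
    fix x :: fts
    obtain a1 a2 a3 a4 a5 a6 where x: "x = (a1, (a2, a3), (a4, a5), a6)" by (metis surj_pair)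
    show "quartic x = - 1 * ?f1 x + - 4 * ?f2 x + - 4 * ?f3 x + 4 * ?f4 x + 8 * ?f5 x"
      by (simp add: x P_def defs power2_eq_square algebra_simps)
  qed
  have comb: "polar4 (\<lambda>x. c1 * f1 x + c2 * f2 x + c3 * f3 x + c4 * f4 x + c5 * f5 x) x y w =
    (\<lambda>z. c1 * polar4 f1 x y w z + c2 * polar4 f2 x y w z + c3 * polar4 f3 x y w z
      + c4 * polar4 f4 x y w z + c5 * polar4 f5 x y w z)" for c1 c2 c3 c4 c5 f1 f2 f3 f4 f5
    by (rule ext) (simp add: polar4_def field_simps)
  have sc: "linear (\<lambda>z. k * g z)" if "linear g" for k and g :: "fts \<Rightarrow> real"
    using linear_compose_scale_right[OF that, of k] by simp
  show ?thesis
    unfolding quartic4_def q comb by (intro linear_compose_add sc l)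
qed

definition triple :: "fts \<Rightarrow> fts \<Rightarrow> fts \<Rightarrow> fts" where
  "triple x y w = (THE t. \<forall>z. sform t z = 2 * quartic4 x y w z)"

lemma ex1_sform_representation:
  assumes "linear f"
  shows "\<exists>!t. \<forall>z. sform t z = f z"
proof -
  let ?e1 = "(1, (0, 0), (0, 0), 0) :: fts" and ?e2 = "(0, (1, 0), (0, 0), 0) :: fts"
  let ?e3 = "(0, (0, 1), (0, 0), 0) :: fts" and ?e4 = "(0, (0, 0), (1, 0), 0) :: fts"
  let ?e5 = "(0, (0, 0), (0, 1), 0) :: fts" and ?e6 = "(0, (0, 0), (0, 0), 1) :: fts"
  let ?t = "(f ?e6, (f ?e4, f ?e5 / 2), (- f ?e2, - f ?e3 / 2), - f ?e1)"
  show ?thesis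
  proof (rule ex1I[of _ ?t], intro allI)
    fix z :: fts
    obtain d1 d2 d3 d4 d5 d6 where z: "z = (d1, (d2, d3), (d4, d5), d6)" by (metis surj_pair)
    have "z = d1 *\<^sub>R ?e1 + d2 *\<^sub>R ?e2 + d3 *\<^sub>R ?e3 + d4 *\<^sub>R ?e4 + d5 *\<^sub>R ?e5 + d6 *\<^sub>R ?e6"
      by (simp add: z)
    then have "f z = d1 * f ?e1 + d2 * f ?e2 + d3 * f ?e3 + d4 * f ?e4 + d5 * f ?e5 + d6 * f ?e6"
      by (simp only: linear_add[OF assms] linear_scale[OF assms] real_scaleR_def)
    then show "sform ?t z = f z" by (simp add: z)
  next
    fix t assume t: "\<forall>z. sform t z = f z"
    obtain d1 d2 d3 d4 d5 d6 where d: "t = (d1, (d2, d3), (d4, d5), d6)" by (metis surj_pair)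
    show "t = ?t"
      using t[rule_format, of ?e1] t[rule_format, of ?e2] t[rule_format, of ?e3]
        t[rule_format, of ?e4] t[rule_format, of ?e5] t[rule_format, of ?e6]
      by (simp add: d)
  qed
qed

lemma sform_triple: "sform (triple x y w) z = 2 * quartic4 x y w z"
proof -
  have "linear (\<lambda>z. 2 * quartic4 x y w z)"
    using linear_compose_scale_right[OF linear_quartic4, of 2 x y w] by simp
  from theI'[OF ex1_sform_representation[OF this]] show ?thesis
    unfolding triple_def by blast
qed

text \<open>\<open>upsilon x y\<close> is \<open>\<Upsilon>(x, x, y)\<close>.\<close>

definition upsilon :: "fts \<Rightarrow> fts \<Rightarrow> fts" where
  "upsilon x y = 3 *\<^sub>R triple x x y + sform x y *\<^sub>R x"

definition rank1 :: "fts \<Rightarrow> bool" where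
  "rank1 x \<longleftrightarrow> x \<noteq> 0 \<and> (\<forall>y. upsilon x y = 0)"

definition rank2 :: "fts \<Rightarrow> bool" where
  "rank2 x \<longleftrightarrow> x \<noteq> 0 \<and> triple x x x = 0 \<and> (\<exists>y. upsilon x y \<noteq> 0)"

definition rank3 :: "fts \<Rightarrow> bool" where
  "rank3 x \<longleftrightarrow> x \<noteq> 0 \<and> quartic x = 0 \<and> triple x x x \<noteq> 0"

definition rank4 :: "fts \<Rightarrow> bool" where
  "rank4 x \<longleftrightarrow> x \<noteq> 0 \<and> quartic x \<noteq> 0"

section \<open>The groups\<close>

definition AutF :: "(fts \<Rightarrow> fts) monoid" where
  "AutF = \<lparr>carrier = {\<sigma>. linear \<sigma> \<and> bij \<sigma> \<and>
                         (\<forall>x y. sform (\<sigma> x) (\<sigma> y) = sform x y) \<and>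
                         (\<forall>x. quartic (\<sigma> x) = quartic x)},
           mult = (\<circ>), one = id\<rparr>"

definition related :: "fts \<Rightarrow> fts \<Rightarrow> bool" where
  "related x x' \<longleftrightarrow> (\<exists>\<sigma> \<in> carrier AutF. x' = \<sigma> x)"

definition SL2R :: "(real^2^2) monoid" where
  "SL2R = \<lparr>carrier = {M. det M = 1}, mult = (**), one = mat 1\<rparr>"

definition eta :: "real^3^3" where
  "eta = (\<chi> i j. if i = j then (if i = 3 then - 1 else 1) else 0)"

definition SO21 :: "(real^3^3) monoid" where
  "SO21 = \<lparr>carrier = {M. transpose M ** eta ** M = eta \<and> det M = 1}, mult = (**), one = mat 1\<rparr>"

lemma group_AutF: "group AutF"
proof (rule groupI)
  fix \<sigma> assume \<sigma>: "\<sigma> \<in> carrier AutF"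
  then have b: "bij \<sigma>" and l: "linear \<sigma>" and s: "sform (\<sigma> x) (\<sigma> y) = sform x y"
    and q: "quartic (\<sigma> x) = quartic x" for x y
    by (simp_all add: AutF_def del: split_paired_All)
  have r: "\<sigma> (inv_into UNIV \<sigma> x) = x" for x using b by (simp add: bij_is_surj surj_f_inv_f)
  have "linear (inv_into UNIV \<sigma>)"
    using l b by (intro inj_linear_imp_inv_linear) (auto simp: bij_is_inj)
  moreover have "sform (inv_into UNIV \<sigma> x) (inv_into UNIV \<sigma> y) = sform x y" for x y
    using s[of "inv_into UNIV \<sigma> x" "inv_into UNIV \<sigma> y"] by (simp only: r)
  moreover have "quartic (inv_into UNIV \<sigma> x) = quartic x" for x
    using q[of "inv_into UNIV \<sigma> x"] by (simp only: r)
  ultimately have "inv_into UNIV \<sigma> \<in> carrier AutF"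
    using bij_imp_bij_inv[OF b] by (simp add: AutF_def del: split_paired_All)
  then show "\<exists>\<tau> \<in> carrier AutF. \<tau> \<otimes>\<^bsub>AutF\<^esub> \<sigma> = \<one>\<^bsub>AutF\<^esub>"
    using b by (intro bexI[of _ "inv_into UNIV \<sigma>"]) (simp_all add: AutF_def bij_is_inj)
qed (simp_all add: AutF_def linear_compose bij_comp linear_id o_assoc del: split_paired_All)

lemma group_SL2R: "group SL2R"
proof (rule groupI)
  fix M assume "M \<in> carrier SL2R"
  then have M: "det M = 1" by (simp add: SL2R_def)
  then obtain M' where M': "M' ** M = mat 1"
    using invertible_det_nz[of M] by (auto simp: invertible_def)
  then have "det M' = 1" using M det_mul[of M' M] by simp
  then show "\<exists>N \<in> carrier SL2R. N \<otimes>\<^bsub>SL2R\<^esub> M = \<one>\<^bsub>SL2R\<^esub>"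
    using M' by (auto simp: SL2R_def)
qed (auto simp: SL2R_def det_mul matrix_mul_assoc)

lemma group_SO21: "group SO21"
proof (rule groupI)
  fix M N assume "M \<in> carrier SO21" "N \<in> carrier SO21"
  then have M: "transpose M ** eta ** M = eta" "det M = 1"
    and N: "transpose N ** eta ** N = eta" "det N = 1" by (auto simp: SO21_def)
  have "transpose (M ** N) ** eta ** (M ** N) = transpose N ** (transpose M ** eta ** M) ** N"
    by (simp add: matrix_transpose_mul matrix_mul_assoc)
  then show "M \<otimes>\<^bsub>SO21\<^esub> N \<in> carrier SO21" using M N by (simp add: SO21_def det_mul)
next
  fix M assume "M \<in> carrier SO21"
  then have M: "transpose M ** eta ** M = eta" "det M = 1" by (auto simp: SO21_def)
  then obtain M' where M': "M' ** M = mat 1" "M ** M' = mat 1"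
    using invertible_det_nz[of M] by (auto simp: invertible_def)
  have d: "det M' = 1" using M M' det_mul[of M' M] by simp
  have "transpose M' ** eta ** M' = transpose M' ** (transpose M ** eta ** M) ** M'"
    using M by simp
  also have "\<dots> = transpose (M ** M') ** eta ** (M ** M')"
    by (simp add: matrix_transpose_mul matrix_mul_assoc)
  also have "\<dots> = eta" by (simp add: M' transpose_mat)
  finally show "\<exists>N \<in> carrier SO21. N \<otimes>\<^bsub>SO21\<^esub> M = \<one>\<^bsub>SO21\<^esub>"
    using M' d by (auto simp: SO21_def)
qed (auto simp: SO21_def matrix_mul_assoc transpose_mat)

end

theory Submission
  imports Defs
begin

text \<open>The triple system is the tensor product of the plane with Minkowski space: an
element is a pair \<open>(P, Q)\<close> of vectors in \<open>\<real>\<^sup>3\<close> with the form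
\<open>\<langle>u, v\<rangle> = u\<^sub>1v\<^sub>1 + u\<^sub>2v\<^sub>2 - u\<^sub>3v\<^sub>3\<close>. In this picture the symplectic form is, up to the
factor \<open>- 2\<close>, the product of the area form of the plane with the Lorentz form, and the
quartic form is four times the Gram determinant of \<open>P\<close> and \<open>Q\<close> (\<open>sform_pack\<close>,
\<open>quartic_pack\<close>). Both are visibly invariant under \<open>M \<otimes> N\<close> with \<open>M\<close> in \<open>SL(2)\<close> and \<open>N\<close> in
\<open>SO(2,1)\<close>.

That there are no further automorphisms rests on a description of the pure tensors which
every automorphism respects: \<open>T(x) = 0\<close> holds exactly if \<open>P\<close> and \<open>Q\<close> are parallel
(\<open>triple_eq_0_iff\<close>), because \<open>T\<close> is, up to a factor and the duality given by the
symplectic form, the gradient of the Gram determinant, and the Lorentz form has no totally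
isotropic plane. An automorphism therefore maps pure tensors to pure tensors. Its
restriction to \<open>v \<otimes> \<real>\<^sup>3\<close> has for this reason the form \<open>v \<otimes> p \<mapsto> w \<otimes> h(p)\<close>
(\<open>parallel_family_factors\<close>), and comparing two choices of \<open>v\<close> shows that the whole map is
some \<open>M \<otimes> N\<close>. Preservation of the symplectic form makes \<open>N\<close> a similitude with ratio
\<open>1 / det M\<close>. Taking determinants, which is informative because the dimension 3 is odd,
gives \<open>det M > 0\<close>, and a scalar can be moved from one factor to the other so that \<open>M\<close> and
\<open>N\<close> land in \<open>SL(2)\<close> and \<open>SO(2,1)\<close>. The same odd dimension makes this normalization unique.

For the orbits, \<open>SL(2)\<close> changes the basis of the plane; this diagonalizes the Gram matrix,
so \<open>P\<close> and \<open>Q\<close> may be taken orthogonal. The remaining cases are governed by which of them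
are zero, null, spacelike or timelike, and in each case a Lorentz frame adapted to \<open>P\<close> and
\<open>Q\<close> moves the pair to a standard one (\<open>canonical_forms\<close>). The vanishing of \<open>\<Delta>\<close>, \<open>T\<close> and
\<open>\<Upsilon>\<close> is constant on orbits and can be read off the standard pairs, so the rank decides
which of them are possible.\<close>

section \<open>The Lorentz form\<close>

definition lor :: "real^3 \<Rightarrow> real^3 \<Rightarrow> real" where
  "lor u v = u$1 * v$1 + u$2 * v$2 - u$3 * v$3"

lemma lor_commute: "lor u v = lor v u"
  by (simp add: lor_def)

lemma lor_linear [simp]:
  "lor (u + v) w = lor u w + lor v w" "lor w (u + v) = lor w u + lor w v"
  "lor (u - v) w = lor u w - lor v w" "lor w (u - v) = lor w u - lor w v"
  "lor (c *\<^sub>R u) w = c * lor u w" "lor w (c *\<^sub>R u) = c * lor w u"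
  "lor (- u) w = - lor u w" "lor w (- u) = - lor w u" "lor 0 w = 0" "lor w 0 = 0"
  by (simp_all add: lor_def algebra_simps)

lemma lor_eq_inner: "lor u v = u \<bullet> (eta *v v)"
  by (simp add: lor_def eta_def inner_vec_def matrix_vector_mult_def sum_3)

lemma lor_nondegenerate:
  assumes "\<And>v. lor u v = 0"
  shows "u = 0"
  using assms[of "axis 1 1"] assms[of "axis 2 1"] assms[of "axis 3 1"]
  by (simp add: lor_def vec_eq_iff forall_3 axis_def)

text \<open>For \<open>c = 1\<close> and determinant \<open>1\<close> this describes \<open>SO(2,1)\<close> by invariance of the
form. Other values of \<open>c\<close> occur before the factors of a tensor product are normalized.\<close>

lemma similitude_iff:
  fixes N :: "real^3^3"
  shows "transpose N ** eta ** N = c *\<^sub>R eta \<longleftrightarrow> (\<forall>u v. lor (N *v u) (N *v v) = c * lor u v)"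
proof -
  have "u \<bullet> ((transpose N ** eta ** N) *v v) = u \<bullet> (transpose N *v (eta *v (N *v v)))" for u v
    by (simp only: matrix_vector_mul_assoc matrix_mul_assoc)
  moreover have "u \<bullet> (transpose N *v (eta *v (N *v v))) = lor (N *v u) (N *v v)" for u v
    unfolding lor_eq_inner using dot_lmul_matrix[of "eta *v (N *v v)" N u]
    by (simp only: inner_commute transpose_matrix_vector)
  moreover have "c * lor u v = u \<bullet> ((c *\<^sub>R eta) *v v)" for u v
    by (simp only: lor_eq_inner scaleR_matrix_vector_assoc[symmetric] inner_scaleR_right)
  ultimately have "(\<forall>u v. lor (N *v u) (N *v v) = c * lor u v) \<longleftrightarrow>
      (\<forall>v u. u \<bullet> ((transpose N ** eta ** N) *v v) = u \<bullet> ((c *\<^sub>R eta) *v v))"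
    by auto
  then show ?thesis
    by (simp only: vector_eq_ldot matrix_eq)
qed

lemma SO21_iff:
  "N \<in> carrier SO21 \<longleftrightarrow> (\<forall>u v. lor (N *v u) (N *v v) = lor u v) \<and> det N = 1"
  using similitude_iff[of N 1] by (simp add: SO21_def)

lemma lor_eta: "lor u (eta *v v) = u \<bullet> v" "lor (eta *v v) u = v \<bullet> u"
  "lor (eta *v u) (eta *v v) = lor u v"
  by (simp_all add: lor_def eta_def inner_vec_def matrix_vector_mult_def sum_3)

lemma lor_cross3: "lor (cross3 u v) (cross3 u v) = (lor u v)\<^sup>2 - lor u u * lor v v"
  by (simp add: lor_def cross3_def power2_eq_square algebra_simps)

lemma cross3_eq_0_imp:
  assumes "cross3 u v = 0" "v \<noteq> 0"
  obtains c where "u = c *\<^sub>R v"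
proof -
  have "collinear {0, v, u}"
    using assms(1) by (simp add: cross_eq_0 insert_commute)
  then show thesis
    using assms(2) that[of 0] that by (auto simp: collinear_lemma)
qed

text \<open>Signature \<open>(2,1)\<close> leaves no room for an isotropic plane. The spatial parts of
two orthogonal null vectors attain equality in the Cauchy--Schwarz inequality, so the
third component of the cross product vanishes. By \<open>lor_cross3\<close> the cross product of an
isotropic pair is itself null, so the other two components vanish with it.\<close>

lemma isotropic_imp_parallel:
  assumes "lor P P = 0" "lor Q Q = 0" "lor P Q = 0"
  shows "cross3 P Q = 0"
proof -
  let ?c = "cross3 P Q"
  have "(?c$3)\<^sup>2 = (P$1 * P$1 + P$2 * P$2) * (Q$1 * Q$1 + Q$2 * Q$2) - (P$1 * Q$1 + P$2 * Q$2)\<^sup>2"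
    by (simp add: cross3_def power2_eq_square algebra_simps)
  also have "\<dots> = 0"
    using assms by (simp add: lor_def power2_eq_square)
  finally have 3: "?c$3 = 0" by simp
  have "lor ?c ?c = 0"
    by (simp add: lor_cross3 assms)
  with 3 have "(?c$1)\<^sup>2 + (?c$2)\<^sup>2 = 0"
    by (simp add: lor_def power2_eq_square)
  with 3 show ?thesis
    by (simp add: vec_eq_iff forall_3 sum_power2_eq_zero_iff)
qed

text \<open>A reversed Cauchy--Schwarz argument: the time components of two timelike
vectors outweigh the inner product of their spatial parts.\<close>

lemma no_orthogonal_timelike_pair:
  assumes "lor p p < 0" "lor q q < 0"
  shows "lor p q \<noteq> 0"
proof
  assume "lor p q = 0"
  then have "(p$3 * q$3)\<^sup>2 = (p$1 * q$1 + p$2 * q$2)\<^sup>2"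
    by (simp add: lor_def)
  also have "\<dots> \<le> (p$1 * p$1 + p$2 * p$2) * (q$1 * q$1 + q$2 * q$2)"
    using zero_le_square[of "p$1 * q$2 - p$2 * q$1"]
    by (simp add: power2_eq_square algebra_simps)
  also have "\<dots> < (p$3 * p$3) * (q$3 * q$3)"
    using assms by (intro mult_strict_mono') (simp_all add: lor_def)
  finally show False by (simp add: power2_eq_square algebra_simps)
qed

lemma ex_spacelike_orthogonal: "\<exists>u. lor u u = 1 \<and> lor u p = 0"
proof (cases "p$1 = 0 \<and> p$2 = 0")
  case True
  then show ?thesis by (intro exI[of _ "axis 1 1"]) (simp add: lor_def axis_def)
next
  case False
  define r where "r = sqrt ((p$1)\<^sup>2 + (p$2)\<^sup>2)"
  have r: "r * r = p$1 * p$1 + p$2 * p$2" "r \<noteq> 0"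
    using False by (auto simp: r_def power2_eq_square sum_squares_eq_zero_iff)
  show ?thesis
    using False r by (intro exI[of _ "(1 / r) *\<^sub>R vector [p$2, - p$1, 0]"])
      (simp add: lor_def add_divide_distrib[symmetric] add.commute[of "p$2 * p$2"])
qed

section \<open>Elements as pairs of Lorentz vectors\<close>

text \<open>The rows \<open>P\<close> and \<open>Q\<close> of the tensor collect the coordinates \<open>(\<alpha>, a, b\<^sub>0)\<close> and
\<open>(b, \<beta>, a\<^sub>0)\<close>. The first two entries of each are light-cone coordinates, the quadratic
form of the first row being \<open>b\<^sub>0\<^sup>2 - \<alpha>a\<close>; the sums and differences turn it into
\<open>P\<^sub>1\<^sup>2 + P\<^sub>2\<^sup>2 - P\<^sub>3\<^sup>2\<close>.\<close>

definition pack :: "real^3 \<Rightarrow> real^3 \<Rightarrow> fts" where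
  "pack P Q = (P$3 + P$2, (P$3 - P$2, Q$1), (Q$3 + Q$2, P$1), Q$3 - Q$2)"

fun upper :: "fts \<Rightarrow> real^3" where
  "upper (\<alpha>, (a, a0), (b, b0), \<beta>) = vector [b0, (\<alpha> - a) / 2, (\<alpha> + a) / 2]"

fun lower :: "fts \<Rightarrow> real^3" where
  "lower (\<alpha>, (a, a0), (b, b0), \<beta>) = vector [a0, (b - \<beta>) / 2, (b + \<beta>) / 2]"

lemma upper_pack [simp]: "upper (pack P Q) = P"
  and lower_pack [simp]: "lower (pack P Q) = Q"
  by (simp_all add: pack_def vec_eq_iff forall_3)

lemma pack_upper_lower [simp]: "pack (upper x) (lower x) = x"
  by (cases x rule: upper.cases) (simp add: pack_def field_simps)

lemma pack_cases [cases type]: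
  obtains P Q where "x = pack P Q"
  by (metis pack_upper_lower)

lemma pack_add: "pack P Q + pack R S = pack (P + R) (Q + S)"
  and pack_scaleR: "c *\<^sub>R pack P Q = pack (c *\<^sub>R P) (c *\<^sub>R Q)"
  by (simp_all add: pack_def algebra_simps)

lemma pack_eq_iff: "pack P Q = pack R S \<longleftrightarrow> P = R \<and> Q = S"
  by (metis upper_pack lower_pack)

lemma pack_0: "pack 0 0 = 0"
  by (simp add: pack_def zero_prod_def)

lemma linear_upper: "linear upper" and linear_lower: "linear lower"
proof -
  show "linear upper"
  proof (rule linearI)
    fix x y show "upper (x + y) = upper x + upper y"
      by (cases x; cases y) (simp add: pack_add)
  next
    fix c x show "upper (c *\<^sub>R x) = c *\<^sub>R upper x"
      by (cases x) (simp add: pack_scaleR)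
  qed
  show "linear lower"
  proof (rule linearI)
    fix x y show "lower (x + y) = lower x + lower y"
      by (cases x; cases y) (simp add: pack_add)
  next
    fix c x show "lower (c *\<^sub>R x) = c *\<^sub>R lower x"
      by (cases x) (simp add: pack_scaleR)
  qed
qed

lemma sform_pack: "sform (pack P Q) (pack R S) = - 2 * (lor P S - lor Q R)"
  by (simp add: pack_def lor_def algebra_simps)

lemma quartic_pack: "quartic (pack P Q) = 4 * (lor P P * lor Q Q - (lor P Q)\<^sup>2)"
  by (simp add: pack_def lor_def power2_eq_square algebra_simps)

text \<open>The polarization of four times the Gram determinant, with two equal arguments:
the diagonal in the first three slots gives \<open>T\<close>, and two equal slots are what \<open>\<Upsilon>\<close> needs.\<close>

lemma quartic4_pack:
  "quartic4 (pack P Q) (pack P Q) (pack R S) (pack U V) =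
   2 / 3 * (lor P P * lor S V + lor Q Q * lor R U + 2 * lor P R * lor Q V + 2 * lor P U * lor Q S
    - lor P Q * (lor R V + lor U S) - (lor P S + lor R Q) * (lor P V + lor U Q))"
  unfolding quartic4_def polar4_def pack_add quartic_pack lor_linear power2_eq_square
    lor_commute[of R P] lor_commute[of U P] lor_commute[of U R] lor_commute[of S Q]
    lor_commute[of V Q] lor_commute[of V S] lor_commute[of Q P] lor_commute[of S P]
    lor_commute[of V P] lor_commute[of Q R] lor_commute[of Q U] lor_commute[of S R]
    lor_commute[of S U] lor_commute[of V R] lor_commute[of V U]
  by (simp add: field_simps)

section \<open>Tensor products of linear maps as automorphisms\<close>

definition tensor :: "real^2^2 \<Rightarrow> real^3^3 \<Rightarrow> fts \<Rightarrow> fts" where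
  "tensor M N x = pack
     (M$1$1 *\<^sub>R (N *v upper x) + M$1$2 *\<^sub>R (N *v lower x))
     (M$2$1 *\<^sub>R (N *v upper x) + M$2$2 *\<^sub>R (N *v lower x))"

lemma tensor_pack:
  "tensor M N (pack P Q) = pack
     (M$1$1 *\<^sub>R (N *v P) + M$1$2 *\<^sub>R (N *v Q))
     (M$2$1 *\<^sub>R (N *v P) + M$2$2 *\<^sub>R (N *v Q))"
  by (simp add: tensor_def)

lemma linear_tensor: "linear (tensor M N)"
proof (rule linearI)
  fix x y show "tensor M N (x + y) = tensor M N x + tensor M N y"
    by (cases x; cases y) (simp add: tensor_pack pack_add matrix_vector_right_distrib algebra_simps)
next
  fix c x show "tensor M N (c *\<^sub>R x) = c *\<^sub>R tensor M N x"
    by (cases x) (simp add: tensor_pack pack_scaleR matrix_vector_mult_scaleR algebra_simps)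
qed

lemma tensor_mult: "tensor (M ** M') (N ** N') x = tensor M N (tensor M' N' x)"
  by (cases x) (simp add: tensor_pack pack_eq_iff matrix_matrix_mult_def[of M M'] sum_2
      matrix_vector_mul_assoc[symmetric] matrix_vector_right_distrib matrix_vector_mult_scaleR
      algebra_simps)

lemma tensor_one: "tensor (mat 1) (mat 1) x = x"
  by (cases x) (simp add: tensor_pack mat_def[where 'n = 2])

lemma sform_tensor:
  assumes "\<And>u v. lor (N *v u) (N *v v) = c * lor u v"
  shows "sform (tensor M N x) (tensor M N y) = det M * c * sform x y"
  by (cases x; cases y) (simp add: tensor_pack sform_pack assms det_2 algebra_simps)

lemma quartic_tensor:
  assumes "\<And>u v. lor (N *v u) (N *v v) = c * lor u v"
  shows "quartic (tensor M N x) = (det M * c)\<^sup>2 * quartic x"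
proof (cases x)
  case (1 P Q)
  show ?thesis
    unfolding 1 tensor_pack quartic_pack lor_linear assms lor_commute[of Q P] det_2
    by (simp add: power2_eq_square algebra_simps)
qed

lemma tensor_in_AutF:
  assumes "M \<in> carrier SL2R" "N \<in> carrier SO21"
  shows "tensor M N \<in> carrier AutF"
proof -
  obtain M' where M': "M' \<in> carrier SL2R" "M' ** M = mat 1" "M ** M' = mat 1"
    using group.l_inv_ex[OF group_SL2R assms(1)] group.r_inv_ex[OF group_SL2R assms(1)]
    by (auto simp: SL2R_def matrix_left_right_inverse)
  obtain N' where N': "N' \<in> carrier SO21" "N' ** N = mat 1" "N ** N' = mat 1"
    using group.l_inv_ex[OF group_SO21 assms(2)]
    by (auto simp: SO21_def matrix_left_right_inverse)
  have "tensor M' N' (tensor M N x) = x" "tensor M N (tensor M' N' x) = x" for x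
    by (simp_all add: tensor_mult[symmetric] M' N' tensor_one)
  then have "bij (tensor M N)"
    by (intro o_bij[of "tensor M' N'"]) (simp_all add: fun_eq_iff)
  moreover have "det M = 1" and N: "lor (N *v u) (N *v v) = 1 * lor u v" for u v
    using assms by (auto simp: SL2R_def SO21_iff)
  ultimately show ?thesis
    by (auto simp: AutF_def linear_tensor sform_tensor[OF N] quartic_tensor[OF N]
        simp del: split_paired_All)
qed

section \<open>The triple product and parallel pairs\<close>

lemma sform_nondegenerate:
  assumes "\<And>z. sform x z = 0"
  shows "x = 0"
proof (cases x)
  case (1 P Q)
  have "lor P v = 0" "lor Q v = 0" for v
    using assms[of "pack 0 v"] assms[of "pack v 0"] by (simp_all add: 1 sform_pack)
  then have "P = 0" "Q = 0" by (auto intro: lor_nondegenerate)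
  then show ?thesis
    by (simp add: 1 pack_0)
qed

lemma sform_left_cancel:
  assumes "\<And>z. sform x z = sform y z"
  shows "x = y"
proof -
  have "sform (x - y) z = sform x z - sform y z" for z
    by (cases x; cases y; cases z) (simp add: pack_def sform_pack algebra_simps)
  then show ?thesis
    using sform_nondegenerate[of "x - y"] assms by simp
qed

lemma triple_pack:
  "triple (pack P Q) (pack P Q) (pack P Q) =
   2 *\<^sub>R pack (lor P Q *\<^sub>R P - lor P P *\<^sub>R Q) (lor Q Q *\<^sub>R P - lor P Q *\<^sub>R Q)"
proof (rule sform_left_cancel)
  fix z show "sform (triple (pack P Q) (pack P Q) (pack P Q)) z =
    sform (2 *\<^sub>R pack (lor P Q *\<^sub>R P - lor P P *\<^sub>R Q) (lor Q Q *\<^sub>R P - lor P Q *\<^sub>R Q)) z"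
  proof (cases z)
    case (1 R S)
    show ?thesis
      unfolding 1 sform_triple quartic4_pack pack_scaleR sform_pack lor_linear
        lor_commute[of Q P] lor_commute[of R P] lor_commute[of S P] lor_commute[of R Q]
        lor_commute[of S Q]
      by (simp add: algebra_simps)
  qed
qed

text \<open>The cubic map \<open>T\<close> cuts out the pure tensors. If \<open>T\<close> vanishes while \<open>P\<close> and \<open>Q\<close>
are independent, the coefficients in \<open>triple_pack\<close>, which are the entries of the Gram
matrix, all vanish, and the plane spanned by \<open>P\<close> and \<open>Q\<close> is isotropic.\<close>

lemma triple_eq_0_iff: "triple (pack P Q) (pack P Q) (pack P Q) = 0 \<longleftrightarrow> cross3 P Q = 0"
proof
  assume "triple (pack P Q) (pack P Q) (pack P Q) = 0"
  then have 1: "lor P Q *\<^sub>R P = lor P P *\<^sub>R Q" and 2: "lor Q Q *\<^sub>R P = lor P Q *\<^sub>R Q"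
    by (simp_all add: triple_pack pack_0[symmetric] pack_eq_iff pack_scaleR)
  show "cross3 P Q = 0"
  proof (rule ccontr)
    assume nz: "cross3 P Q \<noteq> 0"
    have "lor P Q *\<^sub>R cross3 P Q = 0" "lor P P *\<^sub>R cross3 P Q = 0" "lor Q Q *\<^sub>R cross3 P Q = 0"
      using arg_cong[OF 1, of "\<lambda>v. cross3 v Q"] arg_cong[OF 1, of "\<lambda>v. cross3 P v"]
        arg_cong[OF 2, of "\<lambda>v. cross3 v Q"]
      by (simp_all add: cross_mult_left cross_mult_right)
    with nz isotropic_imp_parallel[of P Q] show False by simp
  qed
next
  assume c: "cross3 P Q = 0"
  show "triple (pack P Q) (pack P Q) (pack P Q) = 0"
  proof (cases "Q = 0")
    case True
    then show ?thesis by (simp add: triple_pack pack_0)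
  next
    case False
    with c obtain k where "P = k *\<^sub>R Q" by (rule cross3_eq_0_imp)
    then show ?thesis by (simp add: triple_pack pack_0 mult_ac)
  qed
qed

section \<open>Pointwise parallel linear maps\<close>

text \<open>At each point where \<open>g\<close> does not vanish there is a factor of proportionality.
The factors at two points with independent values agree, as one sees at the sum of the
points. After subtracting this multiple of \<open>g\<close>, the remainder \<open>e\<close> is still pointwise
parallel to \<open>g\<close> and vanishes at both points, so each value of \<open>e\<close> is parallel to two
independent vectors.\<close>

lemma proportional_if_rank_ge_2:
  fixes f g :: "real^3 \<Rightarrow> real^3"
  assumes f: "linear f" and g: "linear g" and par: "\<And>p. cross3 (f p) (g p) = 0"
    and indep: "cross3 (g p) (g r) \<noteq> 0"
  obtains c where "\<And>u. f u = c *\<^sub>R g u"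
proof -
  have nz: "g p \<noteq> 0" "g r \<noteq> 0" using indep by auto
  obtain a where a: "f p = a *\<^sub>R g p" using par nz(1) by (rule cross3_eq_0_imp)
  obtain b where b: "f r = b *\<^sub>R g r" using par nz(2) by (rule cross3_eq_0_imp)
  have "(a - b) *\<^sub>R cross3 (g p) (g r) = 0"
    using par[of "p + r"]
    by (simp add: linear_add[OF f] linear_add[OF g] a b cross_add_left cross_add_right
        cross_mult_left cross_mult_right cross_skew[of "g r" "g p"] algebra_simps)
  with indep have ab: "a = b" by simp
  have "f u = a *\<^sub>R g u" for u
  proof (rule ccontr)
    define e where "e v = f v - a *\<^sub>R g v" for v
    assume "f u \<noteq> a *\<^sub>R g u"
    then have e: "e u \<noteq> 0" by (simp add: e_def)
    have "cross3 (e v) (g v) = 0" for v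
      by (simp add: e_def Cross3.left_diff_distrib cross_mult_left par)
    from this[of "u + p"] this[of "u + r"] this[of u]
    have "cross3 (e u) (g p) = 0" "cross3 (e u) (g r) = 0"
      by (simp_all add: e_def linear_add[OF f] linear_add[OF g] a b ab[symmetric] cross_add_right
          algebra_simps)
    then have "cross3 (g p) (e u) = 0" "cross3 (g r) (e u) = 0"
      by (simp_all add: cross_skew[of _ "e u"])
    obtain k where "g p = k *\<^sub>R e u"
      using \<open>cross3 (g p) (e u) = 0\<close> e by (rule cross3_eq_0_imp)
    moreover obtain l where "g r = l *\<^sub>R e u"
      using \<open>cross3 (g r) (e u) = 0\<close> e by (rule cross3_eq_0_imp)
    ultimately show False
      using indep by (simp add: cross_mult_left cross_mult_right)
  qed
  then show thesis by (rule that)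
qed

text \<open>A map whose values lie on a line vanishes as soon as a single scalar coordinate
does.\<close>

lemma functional_if_rank_le_1:
  fixes f :: "real^3 \<Rightarrow> real^3"
  assumes "\<And>p r. cross3 (f p) (f r) = 0"
  obtains w where "\<And>u. f u \<bullet> w = 0 \<Longrightarrow> f u = 0"
proof (cases "\<forall>u. f u = 0")
  case True
  then show ?thesis using that by blast
next
  case False
  then obtain r where r: "f r \<noteq> 0" by blast
  have "f u = 0" if "f u \<bullet> f r = 0" for u
  proof -
    obtain k where "f u = k *\<^sub>R f r" using assms r by (rule cross3_eq_0_imp)
    with that r show ?thesis by simp
  qed
  then show ?thesis by (rule that)
qed

text \<open>If neither map has rank at least 2, each is controlled by a single linear
functional, and two functionals on a space of dimension 3 have a common zero, against the
assumption on the kernels.\<close>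

lemma pointwise_parallel_imp_proportional:
  fixes f g :: "real^3 \<Rightarrow> real^3"
  assumes f: "linear f" and g: "linear g" and par: "\<And>p. cross3 (f p) (g p) = 0"
    and ker: "\<And>p. f p = 0 \<Longrightarrow> g p = 0 \<Longrightarrow> p = 0"
  shows "(\<exists>c. \<forall>u. f u = c *\<^sub>R g u) \<or> (\<exists>c. \<forall>u. g u = c *\<^sub>R f u)"
proof (cases "(\<forall>p r. cross3 (g p) (g r) = 0) \<and> (\<forall>p r. cross3 (f p) (f r) = 0)")
  case False
  have par': "cross3 (g p) (f p) = 0" for p
    using par[of p] cross_skew[of "g p" "f p"] by simp
  from False consider p r where "cross3 (g p) (g r) \<noteq> 0" | p r where "cross3 (f p) (f r) \<noteq> 0"
    by blast
  then show ?thesis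
  proof cases
    case (1 p r)
    from proportional_if_rank_ge_2[OF f g par 1] show ?thesis by blast
  next
    case (2 p r)
    from proportional_if_rank_ge_2[OF g f par' 2] show ?thesis by blast
  qed
next
  case True
  obtain w where w: "\<And>u. f u \<bullet> w = 0 \<Longrightarrow> f u = 0"
    using functional_if_rank_le_1[of f] True by blast
  obtain z where z: "\<And>u. g u \<bullet> z = 0 \<Longrightarrow> g u = 0"
    using functional_if_rank_le_1[of g] True by blast
  define L :: "real^3 \<Rightarrow> real \<times> real" where "L u = (f u \<bullet> w, g u \<bullet> z)" for u
  have L: "linear L"
    by (rule linearI) (simp_all add: L_def linear_add[OF f] linear_add[OF g] linear_scale[OF f]
        linear_scale[OF g] inner_add_left)
  have "inj L"
    unfolding linear_injective_0[OF L]
  proof (intro allI impI)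
    fix u assume "L u = 0"
    then have "f u \<bullet> w = 0" "g u \<bullet> z = 0" by (simp_all add: L_def zero_prod_def)
    then show "u = 0" using ker[OF w z] by blast
  qed
  then have "dim (range L) = dim (UNIV :: (real^3) set)"
    using L by (intro dim_image_eq) auto
  then show ?thesis
    using dim_subset_UNIV[of "range L"] by simp
qed

text \<open>A linear family of pure tensors without kernel consists of tensors
\<open>(a, b) \<otimes> h(p)\<close> with a fixed first factor. The alternative, a fixed second factor, would
only leave room for a family of dimension 2.\<close>

lemma parallel_family_factors:
  fixes f g :: "real^3 \<Rightarrow> real^3"
  assumes "linear f" "linear g" "\<And>p. cross3 (f p) (g p) = 0"
    "\<forall>p. f p = 0 \<and> g p = 0 \<longrightarrow> p = 0"
  shows "\<exists>h a b. linear h \<and> (\<forall>p. f p = a *\<^sub>R h p) \<and> (\<forall>p. g p = b *\<^sub>R h p)"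
proof -
  have "(\<exists>c. \<forall>u. f u = c *\<^sub>R g u) \<or> (\<exists>c. \<forall>u. g u = c *\<^sub>R f u)"
    by (rule pointwise_parallel_imp_proportional[OF assms(1-3)]) (use assms(4) in blast)
  then show ?thesis
  proof (elim disjE exE)
    fix c assume "\<forall>u. f u = c *\<^sub>R g u"
    then show ?thesis
      using assms(2) by (intro exI[of _ g] exI[of _ c] exI[of _ 1]) simp
  next
    fix c assume "\<forall>u. g u = c *\<^sub>R f u"
    then show ?thesis
      using assms(1) by (intro exI[of _ f] exI[of _ 1] exI[of _ c]) simp
  qed
qed

section \<open>Automorphisms are tensor products\<close>

lemma triple_equivariant:
  assumes "\<sigma> \<in> carrier AutF"
  shows "triple (\<sigma> x) (\<sigma> y) (\<sigma> w) = \<sigma> (triple x y w)"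
proof -
  have l: "linear \<sigma>" and s: "\<And>x y. sform (\<sigma> x) (\<sigma> y) = sform x y"
    and q: "\<And>x. quartic (\<sigma> x) = quartic x" and b: "bij \<sigma>"
    using assms by (simp_all add: AutF_def del: split_paired_All)
  have q4: "quartic4 (\<sigma> x) (\<sigma> y) (\<sigma> w) (\<sigma> z) = quartic4 x y w z" for z
    by (simp only: quartic4_def polar4_def linear_add[OF l, symmetric] q)
  have "sform (\<sigma> (triple x y w)) z = 2 * quartic4 (\<sigma> x) (\<sigma> y) (\<sigma> w) z" for z
  proof -
    obtain z' where "z = \<sigma> z'" using b by (meson bij_pointE)
    then show ?thesis by (simp only: s sform_triple q4)
  qed
  moreover have "sform (triple (\<sigma> x) (\<sigma> y) (\<sigma> w)) z = 2 * quartic4 (\<sigma> x) (\<sigma> y) (\<sigma> w) z" for z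
    by (rule sform_triple)
  ultimately show ?thesis
    by (intro sform_left_cancel) simp
qed

text \<open>The argument runs on the invariance of the set of pure tensors. The spaces
\<open>(1,0) \<otimes> \<real>\<^sup>3\<close> and \<open>(0,1) \<otimes> \<real>\<^sup>3\<close> are mapped to \<open>(a,b) \<otimes> h(p)\<close> and \<open>(c,d) \<otimes> k(p)\<close>.
Surjectivity makes \<open>(a,b)\<close> and \<open>(c,d)\<close> independent; since \<open>(1,1) \<otimes> p\<close> has a pure image as
well, \<open>h\<close> and \<open>k\<close> are pointwise parallel, hence multiples of one map.\<close>

lemma AutF_imp_tensor:
  assumes "\<sigma> \<in> carrier AutF"
  obtains M N where "\<sigma> = tensor M N"
proof -
  have l: "linear \<sigma>" and bij: "bij \<sigma>"
    using assms by (simp_all add: AutF_def del: split_paired_All)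
  have inj: "x = 0" if "\<sigma> x = 0" for x
    using that linear_0[OF l] bij_is_inj[OF bij] by (metis injD)
  have lin: "linear (\<lambda>p. upper (\<sigma> (pack p 0)))" "linear (\<lambda>p. lower (\<sigma> (pack p 0)))"
    "linear (\<lambda>p. upper (\<sigma> (pack 0 p)))" "linear (\<lambda>p. lower (\<sigma> (pack 0 p)))"
  proof -
    have "linear (\<lambda>p. pack p 0)" "linear (\<lambda>p. pack 0 p)"
      by (auto intro!: linearI simp: pack_add pack_scaleR)
    from this[THEN linear_compose, OF l] show
      "linear (\<lambda>p. upper (\<sigma> (pack p 0)))" "linear (\<lambda>p. lower (\<sigma> (pack p 0)))"
      "linear (\<lambda>p. upper (\<sigma> (pack 0 p)))" "linear (\<lambda>p. lower (\<sigma> (pack 0 p)))"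
      using linear_compose[OF _ linear_upper] linear_compose[OF _ linear_lower]
      by (fastforce simp: o_def)+
  qed
  have par: "cross3 (upper (\<sigma> (pack P Q))) (lower (\<sigma> (pack P Q))) = 0" if "cross3 P Q = 0" for P Q
  proof -
    have "triple (\<sigma> (pack P Q)) (\<sigma> (pack P Q)) (\<sigma> (pack P Q)) = 0"
      by (simp add: triple_equivariant[OF assms] triple_eq_0_iff[THEN iffD2, OF that] linear_0[OF l])
    then show ?thesis
      using triple_eq_0_iff[of "upper (\<sigma> (pack P Q))" "lower (\<sigma> (pack P Q))"] by simp
  qed
  have ker: "P = 0 \<and> Q = 0" if "upper (\<sigma> (pack P Q)) = 0" "lower (\<sigma> (pack P Q)) = 0" for P Q
  proof -
    have "\<sigma> (pack P Q) = 0"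
      using that pack_upper_lower[of "\<sigma> (pack P Q)"] by (simp add: pack_0)
    then have "pack P Q = 0" by (rule inj)
    then show ?thesis by (simp add: pack_0[symmetric] pack_eq_iff)
  qed
  have par1: "cross3 (upper (\<sigma> (pack p 0))) (lower (\<sigma> (pack p 0))) = 0"
    and par2: "cross3 (upper (\<sigma> (pack 0 p))) (lower (\<sigma> (pack 0 p))) = 0" for p
    by (simp_all add: par)
  have ker1: "\<forall>p. upper (\<sigma> (pack p 0)) = 0 \<and> lower (\<sigma> (pack p 0)) = 0 \<longrightarrow> p = 0"
    and ker2: "\<forall>p. upper (\<sigma> (pack 0 p)) = 0 \<and> lower (\<sigma> (pack 0 p)) = 0 \<longrightarrow> p = 0"
    using ker by blast+
  from parallel_family_factors[OF lin(1,2) par1 ker1] obtain h a b where h: "linear h"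
    "\<And>p. upper (\<sigma> (pack p 0)) = a *\<^sub>R h p" "\<And>p. lower (\<sigma> (pack p 0)) = b *\<^sub>R h p"
    by blast
  from parallel_family_factors[OF lin(3,4) par2 ker2] obtain k c d where k: "linear k"
    "\<And>p. upper (\<sigma> (pack 0 p)) = c *\<^sub>R k p" "\<And>p. lower (\<sigma> (pack 0 p)) = d *\<^sub>R k p"
    by blast
  have split: "\<sigma> (pack P Q) = \<sigma> (pack P 0) + \<sigma> (pack 0 Q)" for P Q
    by (simp add: linear_add[OF l, symmetric] pack_add)
  have up: "upper (\<sigma> (pack P Q)) = a *\<^sub>R h P + c *\<^sub>R k Q" for P Q
    by (simp add: split[of P Q] linear_add[OF linear_upper] h k)
  have lo: "lower (\<sigma> (pack P Q)) = b *\<^sub>R h P + d *\<^sub>R k Q" for P Q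
    by (simp add: split[of P Q] linear_add[OF linear_lower] h k)
  have h0: "p = 0" if "h p = 0" for p
    using ker[of p 0] that by (simp add: h)
  have det: "a * d - b * c \<noteq> 0"
  proof
    assume "a * d - b * c = 0"
    then have "b *\<^sub>R upper (\<sigma> x) = a *\<^sub>R lower (\<sigma> x)" for x
      by (cases x) (simp add: up lo algebra_simps)
    moreover obtain x where "\<sigma> x = pack (b *\<^sub>R axis 1 1) (- a *\<^sub>R axis 1 1)"
      using bij_is_surj[OF bij] by (metis surj_f_inv_f)
    ultimately have "b *\<^sub>R b *\<^sub>R axis 1 1 = a *\<^sub>R - a *\<^sub>R (axis 1 1 :: real^3)"
      by (metis upper_pack lower_pack)
    then have "a\<^sup>2 + b\<^sup>2 = 0"
      by (simp add: vec_eq_iff forall_3 axis_def power2_eq_square)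
    then have "a = 0" "b = 0"
      by (auto simp: sum_power2_eq_zero_iff axis_eq_0_iff)
    then show False
      using ker[of "axis 1 1" 0] by (simp add: h axis_eq_0_iff)
  qed
  have "cross3 (h p) (k p) = 0" for p
  proof -
    have "(a * d - b * c) *\<^sub>R cross3 (h p) (k p) = 0"
      using par[of p p] unfolding up lo
      by (simp add: cross_add_left cross_add_right cross_mult_left cross_mult_right
          cross_skew[of "k p" "h p"] algebra_simps)
    with det show ?thesis by simp
  qed
  moreover have "\<forall>p. h p = 0 \<and> k p = 0 \<longrightarrow> p = 0"
    using h0 by blast
  ultimately obtain g s t where g: "linear g" "\<And>p. h p = s *\<^sub>R g p" "\<And>p. k p = t *\<^sub>R g p"
    using parallel_family_factors[OF h(1) k(1)] by blast
  define M :: "real^2^2" where "M = vector [vector [a * s, c * t], vector [b * s, d * t]]"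
  have "\<sigma> x = tensor M (matrix g) x" for x
  proof (cases x)
    case (1 P Q)
    have "\<sigma> x = pack (upper (\<sigma> x)) (lower (\<sigma> x))" by simp
    then show ?thesis
      by (simp add: 1 up lo g(2,3) tensor_pack M_def g(1))
  qed
  then show thesis using that by blast
qed

lemma det_scaleR_3: "det (c *\<^sub>R A) = c ^ 3 * det A" for A :: "real^3^3"
  by (simp add: det_3 power3_eq_cube algebra_simps)

text \<open>The symplectic form forces \<open>\<langle>N u, N v\<rangle> = \<langle>u, v\<rangle> / D\<close> with \<open>D = det M\<close>, so
\<open>(det N)\<^sup>2 = D\<^sup>-\<^sup>3\<close> and \<open>D\<close> is positive. The scalar moved from \<open>M\<close> to \<open>N\<close> is a square root
of \<open>D\<close>, and its sign is chosen to make the determinant of the second factor \<open>1\<close>.\<close>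

lemma AutF_imp_unimodular_tensor:
  assumes "\<sigma> \<in> carrier AutF"
  obtains M N where "M \<in> carrier SL2R" "N \<in> carrier SO21" "\<sigma> = tensor M N"
proof -
  obtain M N where \<sigma>: "\<sigma> = tensor M N" using AutF_imp_tensor[OF assms] .
  have s: "sform (tensor M N x) (tensor M N y) = sform x y" for x y
    using assms by (simp add: \<sigma> AutF_def del: split_paired_All)
  define D where "D = det M"
  have DN: "D * lor (N *v u) (N *v v) = lor u v" for u v
    using s[of "pack u 0" "pack 0 v"]
    by (simp add: tensor_pack sform_pack D_def det_2 algebra_simps)
  have D0: "D \<noteq> 0"
    using DN[of "axis 1 1" "axis 1 1"] by (auto simp: lor_def axis_def)
  have sim: "transpose N ** eta ** N = (1 / D) *\<^sub>R eta"
    unfolding similitude_iff using DN D0 by (simp add: field_simps)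
  have "det eta = - 1"
    by (simp add: eta_def det_3)
  moreover have "det (transpose N ** eta ** N) = det ((1 / D) *\<^sub>R eta)"
    by (simp only: sim)
  ultimately have dN: "(det N)\<^sup>2 = (1 / D) ^ 3"
    by (simp only: det_mul det_scaleR_3 det_transpose power2_eq_square)
  then have "(1 / D) ^ 3 \<ge> 0" by (metis zero_le_power2)
  then have D: "D > 0" using D0 zero_le_odd_power[of 3 "1 / D"] by simp
  \<comment> \<open>the scalar \<open>s = e * sqrt D\<close> has the sign of \<open>det N\<close>, so that \<open>s\<^sup>3 * det N\<close> is positive\<close>
  define e where "e = (if det N > 0 then 1 else - 1 :: real)"
  define s where "s = e * sqrt D"
  have e2: "e * e = 1" "e ^ 3 = e" by (simp_all add: e_def)
  have s2: "s * s = D" and s0: "s \<noteq> 0"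
    using D e2 by (auto simp: s_def algebra_simps e_def)
  have "(s ^ 3 * det N)\<^sup>2 = (s * s) ^ 3 * (det N)\<^sup>2"
    by (simp add: power_mult_distrib power2_eq_square power3_eq_cube)
  also have "\<dots> = 1" using D by (simp add: s2 dN power_divide)
  finally have "(s ^ 3 * det N)\<^sup>2 = 1" .
  moreover have "s ^ 3 * det N \<ge> 0"
    using D by (auto simp: s_def power_mult_distrib e2 e_def mult_nonneg_nonpos)
  ultimately have detN: "s ^ 3 * det N = 1"
    unfolding power2_eq_1_iff by auto
  show thesis
  proof (rule that)
    show "s *\<^sub>R N \<in> carrier SO21"
      using DN by (simp add: SO21_iff det_scaleR_3 detN scaleR_matrix_vector_assoc[symmetric]
          s2 mult.assoc[symmetric])
    show "(1 / s) *\<^sub>R M \<in> carrier SL2R"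
      using s2[symmetric] s0 by (simp add: SL2R_def D_def det_2 field_simps)
    show "\<sigma> = tensor ((1 / s) *\<^sub>R M) (s *\<^sub>R N)"
      using s0 by (simp add: \<sigma> tensor_def fun_eq_iff scaleR_matrix_vector_assoc[symmetric])
  qed
qed

text \<open>Cubing is injective on the reals, so equality of the determinants of \<open>M\<^sub>i\<^sub>j N\<close>
and \<open>M'\<^sub>i\<^sub>j N'\<close>, which are \<open>M\<^sub>i\<^sub>j\<^sup>3\<close> and \<open>M'\<^sub>i\<^sub>j\<^sup>3\<close>, already gives \<open>M = M'\<close>.\<close>

lemma inj_on_tensor: "inj_on (\<lambda>(M, N). tensor M N) (carrier (SL2R \<times>\<times> SO21))"
proof (rule inj_onI, clarify)
  fix M M' :: "real^2^2" and N N' :: "real^3^3"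
  assume "(M, N) \<in> carrier (SL2R \<times>\<times> SO21)" "(M', N') \<in> carrier (SL2R \<times>\<times> SO21)"
    and eq: "tensor M N = tensor M' N'"
  then have det: "det M = 1" "det N = 1" "det N' = 1"
    by (auto simp: DirProd_def SL2R_def SO21_def)
  have "(M$1$j *\<^sub>R N) *v p = (M'$1$j *\<^sub>R N') *v p \<and> (M$2$j *\<^sub>R N) *v p = (M'$2$j *\<^sub>R N') *v p"
    for j p
    using fun_cong[OF eq, of "pack p 0"] fun_cong[OF eq, of "pack 0 p"] exhaust_2[of j]
    by (auto simp: tensor_pack pack_eq_iff scaleR_matrix_vector_assoc[symmetric])
  then have N: "M$i$j *\<^sub>R N = M'$i$j *\<^sub>R N'" for i j
    using exhaust_2[of i] by (auto simp: matrix_eq)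
  have "(M$i$j) ^ 3 = (M'$i$j) ^ 3" for i j
    using arg_cong[OF N[of i j], of det] by (simp add: det_scaleR_3 det)
  then have "M$i$j = M'$i$j" for i j
    by (metis odd_numeral odd_real_root_unique)
  then have M: "M = M'" by (simp add: vec_eq_iff)
  have "M \<noteq> 0"
    using det(1) by (auto simp: det_2)
  then obtain i j where "M$i$j \<noteq> 0"
    by (auto simp: vec_eq_iff)
  with N[of i j] show "M = M' \<and> N = N'"
    by (simp add: M)
qed

lemma SL2R_SO21_iso_AutF: "SL2R \<times>\<times> SO21 \<cong> AutF"
proof (rule is_isoI)
  have "bij_betw (\<lambda>(M, N). tensor M N) (carrier (SL2R \<times>\<times> SO21)) (carrier AutF)"
    unfolding bij_betw_def using inj_on_tensor tensor_in_AutF AutF_imp_unimodular_tensor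
    by (auto simp: DirProd_def image_iff) metis
  moreover have "(\<lambda>(M, N). tensor M N) \<in> hom (SL2R \<times>\<times> SO21) AutF"
  proof (rule homI)
    show "(case x of (M, N) \<Rightarrow> tensor M N) \<in> carrier AutF" if "x \<in> carrier (SL2R \<times>\<times> SO21)" for x
      using that tensor_in_AutF by (auto simp: DirProd_def)
    show "(case x \<otimes>\<^bsub>SL2R \<times>\<times> SO21\<^esub> y of (M, N) \<Rightarrow> tensor M N) =
        (case x of (M, N) \<Rightarrow> tensor M N) \<otimes>\<^bsub>AutF\<^esub> (case y of (M, N) \<Rightarrow> tensor M N)" for x y
      by (cases x; cases y) (simp add: DirProd_def SL2R_def SO21_def AutF_def fun_eq_iff tensor_mult)
  qed
  ultimately show "(\<lambda>(M, N). tensor M N) \<in> iso (SL2R \<times>\<times> SO21) AutF"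
    by (simp add: iso_def)
qed

section \<open>Elementary moves within an orbit\<close>

lemma related_trans:
  assumes "related x y" "related y z"
  shows "related x z"
proof -
  obtain \<sigma> \<tau> where "\<sigma> \<in> carrier AutF" "y = \<sigma> x" "\<tau> \<in> carrier AutF" "z = \<tau> y"
    using assms by (auto simp: related_def)
  moreover from this have "\<tau> \<otimes>\<^bsub>AutF\<^esub> \<sigma> \<in> carrier AutF"
    using group.is_monoid[OF group_AutF] by (simp add: monoid.m_closed)
  ultimately show ?thesis
    unfolding related_def by (intro bexI[of _ "\<tau> \<otimes>\<^bsub>AutF\<^esub> \<sigma>"]) (simp_all add: AutF_def)
qed

lemma related_sym:
  assumes "related x y"
  shows "related y x"
proof -
  obtain \<sigma> where \<sigma>: "\<sigma> \<in> carrier AutF" "y = \<sigma> x"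
    using assms by (auto simp: related_def)
  obtain \<tau> where "\<tau> \<in> carrier AutF" "\<tau> \<otimes>\<^bsub>AutF\<^esub> \<sigma> = \<one>\<^bsub>AutF\<^esub>"
    using group.l_inv_ex[OF group_AutF \<sigma>(1)] by blast
  then show ?thesis
    unfolding related_def using \<sigma>(2) by (intro bexI[of _ \<tau>]) (simp_all add: AutF_def fun_eq_iff
        del: split_paired_All)
qed

lemma related_tensor:
  assumes "M \<in> carrier SL2R" "N \<in> carrier SO21"
  shows "related x (tensor M N x)"
  using tensor_in_AutF[OF assms] by (auto simp: related_def)

lemma related_SL2R:
  assumes "a * d - b * c = 1"
  shows "related (pack P Q) (pack (a *\<^sub>R P + b *\<^sub>R Q) (c *\<^sub>R P + d *\<^sub>R Q))"
proof -
  let ?M = "vector [vector [a, b], vector [c, d]] :: real^2^2"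
  have "?M \<in> carrier SL2R" using assms by (simp add: SL2R_def det_2)
  moreover have "mat 1 \<in> carrier SO21" by (simp add: SO21_iff)
  ultimately show ?thesis
    using related_tensor[of ?M "mat 1" "pack P Q"] by (simp add: tensor_pack)
qed

lemma related_swap: "related (pack P Q) (pack Q (- P))"
  using related_SL2R[of 0 0 1 "- 1" P Q] by simp

lemma related_shear: "related (pack P Q) (pack P (Q + c *\<^sub>R P))"
  using related_SL2R[of 1 1 0 c P Q] by (simp add: add.commute)

lemma related_squeeze:
  assumes "t \<noteq> 0"
  shows "related (pack P Q) (pack (t *\<^sub>R P) ((1 / t) *\<^sub>R Q))"
  using related_SL2R[of t "1 / t" 0 0 P Q] assms by simp

lemma related_SO21:
  assumes "N \<in> carrier SO21"
  shows "related (pack P Q) (pack (N *v P) (N *v Q))"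
proof -
  have "mat 1 \<in> carrier SL2R" by (simp add: SL2R_def)
  from related_tensor[OF this assms, of "pack P Q"] show ?thesis
    by (simp add: tensor_pack mat_def[where 'n = 2])
qed

section \<open>Lorentz frames\<close>

definition frame :: "real^3 \<Rightarrow> real^3 \<Rightarrow> real^3 \<Rightarrow> real^3^3" where
  "frame u v w = transpose (vector [u, v, w])"

lemma frame_mult: "frame u v w *v p = p$1 *\<^sub>R u + p$2 *\<^sub>R v + p$3 *\<^sub>R w"
  by (simp add: frame_def matrix_vector_mult_def transpose_def vec_eq_iff forall_3 sum_3)

lemma frame_in_SO21:
  assumes "lor u u = 1" "lor v v = 1" "lor w w = - 1" "lor u v = 0" "lor u w = 0" "lor v w = 0"
    "u \<bullet> cross3 v w = 1"
  shows "frame u v w \<in> carrier SO21"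
proof -
  have "det (frame u v w) = 1"
    using assms(7) by (simp add: frame_def det_transpose dot_cross_det)
  moreover have "lor (frame u v w *v p) (frame u v w *v q) = lor p q" for p q
    using assms(1-6) lor_commute[of v u] lor_commute[of w u] lor_commute[of w v]
    by (simp add: frame_mult lor_def[of p q])
  ultimately show ?thesis by (simp add: SO21_iff)
qed

text \<open>The Lorentzian cross product of the two given vectors completes them to a
frame; the sign of the third vector is dictated by the determinant.\<close>

lemma frame_spacelike:
  assumes "lor u u = 1" "lor v v = 1" "lor u v = 0"
  shows "\<exists>w. frame u v w \<in> carrier SO21"
proof
  let ?w = "- (eta *v cross3 u v)"
  have "cross3 u v \<bullet> ?w = 1"
    using lor_cross3[of u v] assms by (simp add: lor_eq_inner)
  moreover have "u \<bullet> cross3 v ?w = cross3 u v \<bullet> ?w"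
    by (metis cross_triple inner_commute)
  ultimately show "frame u v ?w \<in> carrier SO21"
    using assms lor_cross3[of u v]
    by (intro frame_in_SO21) (simp_all add: lor_eta dot_cross_self inner_commute)
qed

lemma frame_timelike:
  assumes "lor u u = 1" "lor w w = - 1" "lor u w = 0"
  shows "\<exists>v. frame u v w \<in> carrier SO21"
proof
  let ?v = "eta *v cross3 w u"
  have "cross3 w u \<bullet> ?v = 1"
    using lor_cross3[of w u] assms lor_commute[of w u] by (simp add: lor_eq_inner)
  moreover have "u \<bullet> cross3 ?v w = cross3 w u \<bullet> ?v"
    by (metis cross_triple inner_commute)
  ultimately show "frame u ?v w \<in> carrier SO21"
    using assms lor_cross3[of w u] lor_commute[of w u]
    by (intro frame_in_SO21) (simp_all add: lor_eta dot_cross_self inner_commute)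
qed

abbreviation e1 :: "real^3" where "e1 \<equiv> vector [1, 0, 0]"
abbreviation e2 :: "real^3" where "e2 \<equiv> vector [0, 1, 0]"
abbreviation e3 :: "real^3" where "e3 \<equiv> vector [0, 0, 1]"
abbreviation null_dir :: "real^3" where "null_dir \<equiv> vector [0, 1/2, 1/2]"

text \<open>A null vector \<open>p\<close> is completed by the spatial reflection \<open>m\<close> of itself, scaled
to \<open>\<langle>p, m\<rangle> = - 1/2\<close>: the sum and difference of \<open>p\<close> and \<open>m\<close> are then the timelike and the
second spacelike vector of a frame.\<close>

lemma frame_null:
  assumes "lor p p = 0" "p \<noteq> 0"
  obtains N where "N \<in> carrier SO21" "N *v null_dir = p"
proof -
  have z: "p$3 \<noteq> 0" and z2: "p$1 * p$1 + p$2 * p$2 = p$3 * p$3"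
    using assms by (auto simp: lor_def vec_eq_iff forall_3)
  define m where "m = (1 / (4 * (p$3)\<^sup>2)) *\<^sub>R (vector [- p$1, - p$2, p$3] :: real^3)"
  define u where "u = (1 / p$3) *\<^sub>R (vector [p$2, - p$1, 0] :: real^3)"
  have m: "lor m m = 0" "lor p m = - 1 / 2" "lor u p = 0" "lor u m = 0" "lor u u = 1"
    using z z2 by (simp_all add: m_def u_def lor_def field_simps power2_eq_square)
  have "cross3 (p - m) (p + m) = 2 *\<^sub>R cross3 p m"
    by (simp add: cross_add_right Cross3.left_diff_distrib cross_skew[of m p] scaleR_2)
  moreover have "cross3 p m = (1 / 2) *\<^sub>R u"
    using z by (simp add: m_def u_def cross3_def vec_eq_iff forall_3 field_simps power2_eq_square)
  moreover have "u \<bullet> u = 1"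
    using z z2 by (simp add: u_def inner_vec_def sum_3 field_simps)
  ultimately have "u \<bullet> cross3 (p - m) (p + m) = 1" by simp
  then have "frame u (p - m) (p + m) \<in> carrier SO21"
    using m assms(1) lor_commute[of m p] by (intro frame_in_SO21) simp_all
  moreover have "frame u (p - m) (p + m) *v null_dir = p"
    by (simp add: frame_mult vec_eq_iff field_simps)
  ultimately show thesis by (rule that)
qed

text \<open>The boost along the null direction, used to rescale a null vector while fixing
the orthogonal unit vector. For negative \<open>q\<close> it reverses time orientation, which \<open>SO(2,1)\<close>
permits.\<close>

lemma boost:
  assumes "q \<noteq> 0"
  obtains N where "N \<in> carrier SO21" "N *v null_dir = q *\<^sub>R null_dir" "N *v e1 = e1"
proof -
  let ?v = "vector [0, (q + 1 / q) / 2, (q - 1 / q) / 2] :: real^3"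
  let ?w = "vector [0, (q - 1 / q) / 2, (q + 1 / q) / 2] :: real^3"
  have "frame e1 ?v ?w \<in> carrier SO21"
    using assms by (intro frame_in_SO21)
      (simp_all add: lor_def inner_vec_def sum_3 cross3_def field_simps)
  moreover have "frame e1 ?v ?w *v null_dir = q *\<^sub>R null_dir" "frame e1 ?v ?w *v e1 = e1"
    by (simp_all add: frame_mult vec_eq_iff forall_3 field_simps)
  ultimately show thesis by (rule that)
qed

section \<open>Reduction to canonical forms\<close>

text \<open>Once \<open>P\<close> is the standard null vector, its orthogonal complement is spanned by
\<open>P\<close> itself and \<open>e1\<close>. A shear removes the component of \<open>Q\<close> along \<open>P\<close>. A squeeze normalizes
what is left, at the price of rescaling \<open>P\<close>, which a boost repairs.\<close>

lemma related_null:
  assumes "lor P P = 0" "P \<noteq> 0" "lor P Q = 0"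
  shows "related (pack P Q) (pack null_dir 0) \<or> related (pack P Q) (pack null_dir e1)"
proof -
  obtain N where N: "N \<in> carrier SO21" "N *v null_dir = P"
    using frame_null[OF assms(1,2)] .
  then have "invertible N" by (simp add: SO21_iff invertible_det_nz)
  then obtain R where R: "N *v R = Q"
    by (metis invertible_def matrix_vector_mul_assoc matrix_vector_mul_lid)
  have "lor null_dir R = 0"
    using N R assms(3) by (metis SO21_iff)
  then have "R$3 = R$2" by (simp add: lor_def)
  then have "R + (- 2 * R$2) *\<^sub>R null_dir = R$1 *\<^sub>R e1"
    by (simp add: vec_eq_iff forall_3)
  then have "related (pack null_dir R) (pack null_dir (R$1 *\<^sub>R e1))"
    using related_shear[of null_dir R "- 2 * R$2"] by simp
  moreover have "related (pack null_dir R) (pack P Q)"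
    using related_SO21[OF N(1), of null_dir R] by (simp add: N R)
  ultimately have 1: "related (pack P Q) (pack null_dir (R$1 *\<^sub>R e1))"
    using related_sym related_trans by blast
  show ?thesis
  proof (cases "R$1 = 0")
    case True
    with 1 show ?thesis by simp
  next
    case False
    obtain B where B: "B \<in> carrier SO21" "B *v null_dir = (R$1) *\<^sub>R null_dir" "B *v e1 = e1"
      using boost[OF False] .
    have "related (pack null_dir (R$1 *\<^sub>R e1)) (pack (R$1 *\<^sub>R null_dir) e1)"
      using related_squeeze[OF False, of null_dir "R$1 *\<^sub>R e1"] False by simp
    moreover have "related (pack null_dir e1) (pack (R$1 *\<^sub>R null_dir) e1)"
      using related_SO21[OF B(1), of null_dir e1] by (simp add: B)
    ultimately have "related (pack null_dir (R$1 *\<^sub>R e1)) (pack null_dir e1)"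
      using related_sym related_trans by blast
    with 1 show ?thesis using related_trans by blast
  qed
qed

text \<open>After a squeeze to length \<open>1\<close> or \<open>- 1\<close>, the vector is completed to a frame
through an orthogonal spacelike unit vector.\<close>

lemma related_line:
  assumes "lor P P \<noteq> 0"
  shows "related (pack P 0) (pack e3 0) \<or> related (pack P 0) (pack e2 0)"
proof -
  define t where "t = 1 / sqrt \<bar>lor P P\<bar>"
  have "t \<noteq> 0" using assms by (simp add: t_def)
  from related_squeeze[OF this, of P 0]
  have 1: "related (pack P 0) (pack (t *\<^sub>R P) 0)" by simp
  obtain u where u: "lor u u = 1" "lor u (t *\<^sub>R P) = 0"
    using ex_spacelike_orthogonal by blast
  have t: "t * (t * lor P P) = sgn (lor P P)"
    using assms by (simp add: t_def real_sgn_eq)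
  show ?thesis
  proof (cases "lor P P > 0")
    case True
    then obtain w where "frame u (t *\<^sub>R P) w \<in> carrier SO21"
      using frame_spacelike[OF u(1) _ u(2)] t by auto
    from related_SO21[OF this, of e2 0] have "related (pack e2 0) (pack (t *\<^sub>R P) 0)"
      by (simp add: frame_mult)
    then show ?thesis using 1 related_sym related_trans by blast
  next
    case False
    then obtain v where "frame u v (t *\<^sub>R P) \<in> carrier SO21"
      using frame_timelike[OF u(1) _ u(2)] t assms by auto
    from related_SO21[OF this, of e3 0] have "related (pack e3 0) (pack (t *\<^sub>R P) 0)"
      by (simp add: frame_mult)
    then show ?thesis using 1 related_sym related_trans by blast
  qed
qed

definition rank4_form :: "fts \<Rightarrow> bool" where
  "rank4_form x \<longleftrightarrow>
     (\<exists>k > 0. related x (k *\<^sub>R pack e2 e1) \<or> related x (k *\<^sub>R pack e3 e1))"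

lemma rank4_form_related: "related x y \<Longrightarrow> rank4_form y \<Longrightarrow> rank4_form x"
  unfolding rank4_form_def using related_trans by blast

text \<open>A squeeze equalizes the absolute values of \<open>\<langle>P, P\<rangle>\<close> and \<open>\<langle>Q, Q\<rangle>\<close>. Their product
is invariant, so the common length \<open>k\<close> satisfies \<open>k\<^sup>4 = \<bar>\<langle>P, P\<rangle>\<bar> \<langle>Q, Q\<rangle>\<close>, and dividing by
\<open>k\<close> gives two vectors of a frame.\<close>

lemma related_plane_spacelike:
  assumes "lor P P \<noteq> 0" "lor Q Q > 0" "lor P Q = 0"
  shows "rank4_form (pack P Q)"
proof -
  define a where "a = \<bar>lor P P\<bar>"
  define b where "b = lor Q Q"
  have ab: "a > 0" "b > 0" using assms by (simp_all add: a_def b_def)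
  \<comment> \<open>the squeeze by \<open>t\<close> takes \<open>(a, b)\<close> to \<open>(t\<^sup>2 a, b / t\<^sup>2)\<close>, and these agree if \<open>t\<^sup>4 = b / a\<close>\<close>
  define t where "t = sqrt (sqrt (b / a))"
  define k where "k = sqrt (sqrt (a * b))"
  have t: "t > 0" "t * t = sqrt (b / a)" and k: "k > 0" "k * k = sqrt (a * b)"
    using ab by (simp_all add: t_def k_def)
  have ta: "t * t * a = k * k"
    using ab unfolding t k by (simp add: real_sqrt_divide real_sqrt_mult field_simps)
  have tb: "b = t * t * (k * k)"
    using ab unfolding t k by (simp add: real_sqrt_mult[symmetric])
  define u where "u = (1 / (k * t)) *\<^sub>R Q"
  define v where "v = (t / k) *\<^sub>R P"
  have u: "lor u u = 1" and uv: "lor u v = 0"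
    using t(1) k(1) tb assms(3) lor_commute[of P Q]
    by (simp_all add: u_def v_def b_def[symmetric] field_simps)
  have v: "lor v v = sgn (lor P P)"
  proof -
    have "lor v v = t * t * lor P P / (k * k)" by (simp add: v_def)
    also have "lor P P = a * sgn (lor P P)" by (simp add: a_def abs_mult_sgn)
    also have "t * t * (a * sgn (lor P P)) / (k * k) = (t * t * a) / (k * k) * sgn (lor P P)"
      by simp
    also have "\<dots> = sgn (lor P P)"
      unfolding ta using k(1) by simp
    finally show ?thesis using assms(1) by simp
  qed
  have kv: "k *\<^sub>R v = t *\<^sub>R P" "k *\<^sub>R u = (1 / t) *\<^sub>R Q"
    using k(1) by (simp_all add: u_def v_def)
  have 1: "related (pack P Q) (k *\<^sub>R pack v u)"
    using related_squeeze[of t P Q] t(1) by (simp add: pack_scaleR kv)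
  show ?thesis
  proof (cases "lor P P > 0")
    case True
    then obtain w where "frame u v w \<in> carrier SO21"
      using frame_spacelike[OF u _ uv] v by auto
    from related_SO21[OF this, of "k *\<^sub>R e2" "k *\<^sub>R e1"]
    have "related (k *\<^sub>R pack e2 e1) (k *\<^sub>R pack v u)"
      by (simp add: frame_mult pack_scaleR)
    then show ?thesis
      using 1 k(1) related_sym related_trans unfolding rank4_form_def by blast
  next
    case False
    then obtain w where "frame u w v \<in> carrier SO21"
      using frame_timelike[OF u _ uv] v assms by auto
    from related_SO21[OF this, of "k *\<^sub>R e3" "k *\<^sub>R e1"]
    have "related (k *\<^sub>R pack e3 e1) (k *\<^sub>R pack v u)"
      by (simp add: frame_mult pack_scaleR)
    then show ?thesis
      using 1 k(1) related_sym related_trans unfolding rank4_form_def by blast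
  qed
qed

lemma related_plane:
  assumes "lor P P \<noteq> 0" "lor Q Q \<noteq> 0" "lor P Q = 0"
  shows "rank4_form (pack P Q)"
proof (cases "lor Q Q > 0")
  case True
  then show ?thesis using related_plane_spacelike assms by blast
next
  case False
  then have "lor P P > 0"
    using no_orthogonal_timelike_pair[of P Q] assms by fastforce
  then have "rank4_form (pack Q (- P))"
    using assms lor_commute[of P Q] by (intro related_plane_spacelike) simp_all
  then show ?thesis using rank4_form_related related_swap by blast
qed

text \<open>Gram--Schmidt by shears needs a vector that is not null. If both are null,
their sum serves, unless they are orthogonal already.\<close>

lemma related_orthogonal: "\<exists>P' Q'. related (pack P Q) (pack P' Q') \<and> lor P' Q' = 0"
proof -
  have shear: "\<exists>P' Q'. related (pack P Q) (pack P' Q') \<and> lor P' Q' = 0" if "lor P P \<noteq> 0" for P Q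
    using that related_shear[of P Q "- lor P Q / lor P P"]
    by (intro exI[of _ P] exI[of _ "Q + (- lor P Q / lor P P) *\<^sub>R P"]) simp
  consider "lor P P \<noteq> 0" | "lor Q Q \<noteq> 0" | "lor P Q = 0"
    | "lor P P = 0" "lor Q Q = 0" "lor P Q \<noteq> 0" by blast
  then show ?thesis
  proof cases
    case 1
    then show ?thesis by (rule shear)
  next
    case 2
    then show ?thesis using shear[of Q "- P"] related_swap related_trans by blast
  next
    case 3
    have "related (pack P Q) (pack P Q)" using related_shear[of P Q 0] by simp
    with 3 show ?thesis by blast
  next
    case 4
    then have "lor (P + Q) (P + Q) \<noteq> 0" by (simp add: lor_commute[of Q P])
    moreover have "related (pack P Q) (pack (P + Q) Q)"
      using related_SL2R[of 1 1 1 0 P Q] by simp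
    ultimately show ?thesis using shear[of "P + Q" Q] related_trans by blast
  qed
qed

text \<open>With \<open>P\<close> and \<open>Q\<close> orthogonal, at most a swap of the rows is needed to bring one
of the three configurations into position: a null vector with something orthogonal to it,
a single vector that is not null, or a nondegenerate orthogonal pair.\<close>

lemma canonical_forms:
  assumes "x \<noteq> 0"
  shows "related x (pack null_dir 0) \<or> related x (pack e3 0) \<or> related x (pack e2 0) \<or>
    related x (pack null_dir e1) \<or> rank4_form x"
proof -
  let ?C = "\<lambda>x. related x (pack null_dir 0) \<or> related x (pack e3 0) \<or> related x (pack e2 0) \<or>
    related x (pack null_dir e1) \<or> rank4_form x"
  have C: "?C x" if "related x y" "?C y" for x y
    using that related_trans rank4_form_related by blast
  obtain P Q where x: "related x (pack P Q)" and PQ: "lor P Q = 0"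
    using related_orthogonal[of "upper x" "lower x"] by auto
  have nz: "P \<noteq> 0 \<or> Q \<noteq> 0"
  proof (rule ccontr)
    assume "\<not> (P \<noteq> 0 \<or> Q \<noteq> 0)"
    with x obtain \<sigma> where "\<sigma> \<in> carrier AutF" "\<sigma> x = 0"
      by (auto simp: related_def pack_0)
    then have "linear \<sigma>" "inj \<sigma>" "\<sigma> x = 0" by (simp_all add: AutF_def bij_is_inj del: split_paired_All)
    then show False using assms linear_injective_0 by blast
  qed
  have QP: "lor Q (- P) = 0" using PQ lor_commute[of P Q] by simp
  consider "P \<noteq> 0" "lor P P = 0" | "Q \<noteq> 0" "lor Q Q = 0" | "Q = 0" "lor P P \<noteq> 0"
    | "P = 0" "lor Q Q \<noteq> 0" | "lor P P \<noteq> 0" "lor Q Q \<noteq> 0"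
    using nz by blast
  then have "?C (pack P Q)"
  proof cases
    case 1
    then show ?thesis using related_null PQ by blast
  next
    case 2
    then have "?C (pack Q (- P))" using related_null QP by blast
    then show ?thesis using C related_swap by blast
  next
    case 3
    then show ?thesis using related_line by blast
  next
    case 4
    then have "?C (pack Q (- P))" using related_line[of Q] by auto
    then show ?thesis using C related_swap by blast
  next
    case 5
    then show ?thesis using related_plane PQ by blast
  qed
  then show ?thesis using C x by blast
qed

section \<open>Invariants of the canonical forms\<close>

text \<open>On a pure tensor \<open>(1,0) \<otimes> P\<close> the multiple of \<open>x\<close> in \<open>\<Upsilon>\<close> cancels all of
\<open>T(x, x, y)\<close> except a term proportional to \<open>\<langle>P, P\<rangle>\<close>, which is what separates rank 1 from
rank 2.\<close>

lemma sform_upsilon_line: "sform (upsilon (pack P 0) (pack R S)) (pack U V) = 4 * lor P P * lor S V"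
proof -
  have lin: "sform (3 *\<^sub>R a + c *\<^sub>R b) z = 3 * sform a z + c * sform b z" for a b c z
    by (cases a; cases b; cases z) (simp add: pack_scaleR pack_add sform_pack algebra_simps)
  show ?thesis
    unfolding upsilon_def lin sform_triple quartic4_pack sform_pack by (simp add: field_simps)
qed

lemma upsilon_line_eq_0_iff: "(\<forall>y. upsilon (pack P 0) y = 0) \<longleftrightarrow> lor P P = 0"
proof
  assume *: "\<forall>y. upsilon (pack P 0) y = 0"
  have "sform 0 z = 0" for z
    using sform_pack[of 0 0] by (cases z) (simp add: pack_0)
  then show "lor P P = 0"
    using sform_upsilon_line[of P 0 e1 0 e1] * by (simp add: lor_def)
next
  assume P: "lor P P = 0"
  show "\<forall>y. upsilon (pack P 0) y = 0"
  proof
    fix y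
    have "sform (upsilon (pack P 0) y) z = 0" for z
      by (cases y; cases z) (simp add: sform_upsilon_line P)
    then show "upsilon (pack P 0) y = 0" by (rule sform_nondegenerate)
  qed
qed

text \<open>Automorphisms commute with \<open>T\<close> and \<open>\<Upsilon>\<close>, both being built from the two preserved
forms. The rank is therefore the same on both sides of the relation.\<close>

lemma related_invariants:
  assumes "related x y"
  shows "quartic y = quartic x" "triple y y y = 0 \<longleftrightarrow> triple x x x = 0"
    "(\<forall>z. upsilon y z = 0) \<longleftrightarrow> (\<forall>z. upsilon x z = 0)"
proof -
  obtain \<sigma> where \<sigma>: "\<sigma> \<in> carrier AutF" and y: "y = \<sigma> x"
    using assms by (auto simp: related_def)
  then have l: "linear \<sigma>" and b: "bij \<sigma>" and s: "\<And>x y. sform (\<sigma> x) (\<sigma> y) = sform x y"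
    and q: "\<And>x. quartic (\<sigma> x) = quartic x"
    by (simp_all add: AutF_def del: split_paired_All)
  have inj: "\<sigma> v = 0 \<longleftrightarrow> v = 0" for v
    using linear_0[OF l] bij_is_inj[OF b] linear_injective_0[OF l] by metis
  have u: "upsilon (\<sigma> x) (\<sigma> z) = \<sigma> (upsilon x z)" for z
    by (simp only: upsilon_def triple_equivariant[OF \<sigma>] s linear_add[OF l] linear_scale[OF l])
  show "quartic y = quartic x" by (simp only: y q)
  show "triple y y y = 0 \<longleftrightarrow> triple x x x = 0"
    by (simp only: y triple_equivariant[OF \<sigma>] inj)
  have "(\<forall>z. upsilon y z = 0) \<longleftrightarrow> (\<forall>z. upsilon (\<sigma> x) (\<sigma> z) = 0)"
    unfolding y using bij_is_surj[OF b] by (metis surj_f_inv_f)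
  then show "(\<forall>z. upsilon y z = 0) \<longleftrightarrow> (\<forall>z. upsilon x z = 0)"
    by (simp only: u inj)
qed

text \<open>Put \<open>y = x\<close>: the symplectic form is alternating, so \<open>\<Upsilon>(x, x, x) = 3 T(x)\<close>.\<close>

lemma rank1_imp_triple_eq_0:
  assumes "\<forall>y. upsilon x y = 0"
  shows "triple x x x = 0"
proof -
  have "sform x x = 0" by (cases x) (simp add: sform_pack lor_commute)
  with assms[rule_format, of x] show ?thesis by (simp add: upsilon_def)
qed

lemma invariants_line:
  assumes "related x (pack P 0)"
  shows "quartic x = 0" "triple x x x = 0" "(\<forall>y. upsilon x y = 0) \<longleftrightarrow> lor P P = 0"
  using related_invariants[OF assms] upsilon_line_eq_0_iff[of P] triple_eq_0_iff[of P 0]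
  by (auto simp: quartic_pack)

lemma invariants_plane:
  assumes "related x (pack P Q)" "cross3 P Q \<noteq> 0"
  shows "quartic x = 4 * (lor P P * lor Q Q - (lor P Q)\<^sup>2)" "triple x x x \<noteq> 0"
    "\<exists>y. upsilon x y \<noteq> 0"
proof -
  show "quartic x = 4 * (lor P P * lor Q Q - (lor P Q)\<^sup>2)"
    using related_invariants(1)[OF assms(1)] by (simp add: quartic_pack)
  show "triple x x x \<noteq> 0"
    using related_invariants(2)[OF assms(1)] assms(2) by (simp add: triple_eq_0_iff)
  then show "\<exists>y. upsilon x y \<noteq> 0" using rank1_imp_triple_eq_0 by blast
qed

lemma rank4_form_invariants:
  assumes "rank4_form x"
  shows "quartic x \<noteq> 0" "triple x x x \<noteq> 0" "\<exists>y. upsilon x y \<noteq> 0"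
proof -
  obtain k where k: "k > 0" and
    "related x (pack (k *\<^sub>R e2) (k *\<^sub>R e1)) \<or> related x (pack (k *\<^sub>R e3) (k *\<^sub>R e1))"
    using assms by (auto simp: rank4_form_def pack_scaleR)
  moreover have "cross3 (k *\<^sub>R e2) (k *\<^sub>R e1) \<noteq> 0" "cross3 (k *\<^sub>R e3) (k *\<^sub>R e1) \<noteq> 0"
    using k by (simp_all add: cross3_def vec_eq_iff forall_3)
  ultimately show "quartic x \<noteq> 0" "triple x x x \<noteq> 0" "\<exists>y. upsilon x y \<noteq> 0"
    using invariants_plane[of x "k *\<^sub>R e2" "k *\<^sub>R e1"] invariants_plane[of x "k *\<^sub>R e3" "k *\<^sub>R e1"] k
    by (auto simp: lor_def)
qed

theorem theorem3:
  "SL2R \<times>\<times> SO21 \<cong> AutF \<and>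
   (\<forall>x :: fts.
     (rank1 x \<longrightarrow> related x (1, (0, 0), (0, 0), 0)) \<and>
     (rank2 x \<longrightarrow> related x (1, (1, 0), (0, 0), 0) \<or> related x (1, (- 1, 0), (0, 0), 0)) \<and>
     (rank3 x \<longrightarrow> related x (1, (0, 1), (0, 0), 0)) \<and>
     (rank4 x \<longrightarrow> (\<exists>k > 0. related x (k *\<^sub>R (1, (- 1, 1), (0, 0), 0)) \<or>
                             related x (k *\<^sub>R (1, (1, 1), (0, 0), 0)))))"
proof (intro conjI allI SL2R_SO21_iso_AutF)
  fix x :: fts
  have forms: "(1, (0, 0), (0, 0), 0) = pack null_dir 0" "(1, (1, 0), (0, 0), 0) = pack e3 0"
    "(1, (- 1, 0), (0, 0), 0) = pack e2 0" "(1, (0, 1), (0, 0), 0) = pack null_dir e1"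
    "(1, (- 1, 1), (0, 0), 0) = pack e2 e1" "(1, (1, 1), (0, 0), 0) = pack e3 e1"
    by (simp_all add: pack_def)
  have null_dir: "lor null_dir null_dir = 0" "lor null_dir e1 = 0" "cross3 null_dir e1 \<noteq> 0"
    and unit: "lor e3 e3 \<noteq> 0" "lor e2 e2 \<noteq> 0"
    by (simp_all add: lor_def cross3_def vec_eq_iff forall_3)
  note inv = invariants_line[of x null_dir] invariants_line[of x e3] invariants_line[of x e2]
    invariants_plane[of x null_dir e1, OF _ null_dir(3)] rank4_form_invariants[of x]
  show "rank1 x \<longrightarrow> related x (1, (0, 0), (0, 0), 0)"
    unfolding forms rank1_def using canonical_forms[of x] inv null_dir unit by metis
  show "rank2 x \<longrightarrow> related x (1, (1, 0), (0, 0), 0) \<or> related x (1, (- 1, 0), (0, 0), 0)"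
    unfolding forms rank2_def using canonical_forms[of x] inv null_dir unit by metis
  show "rank3 x \<longrightarrow> related x (1, (0, 1), (0, 0), 0)"
    unfolding forms rank3_def using canonical_forms[of x] inv null_dir unit by metis
  have "rank4_form x" if "rank4 x"
  proof -
    have "quartic x \<noteq> 0" "x \<noteq> 0" using that by (simp_all add: rank4_def)
    moreover have "quartic x = 0" if "related x (pack null_dir e1)"
      using inv(10)[OF that] null_dir by simp
    ultimately show ?thesis
      using canonical_forms[of x] inv(1,4,7) by blast
  qed
  then show "rank4 x \<longrightarrow> (\<exists>k > 0. related x (k *\<^sub>R (1, (- 1, 1), (0, 0), 0)) \<or>
                             related x (k *\<^sub>R (1, (1, 1), (0, 0), 0)))"
    unfolding forms rank4_form_def by blast
qed

end
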